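(* (Log-linear model.) Consider a finite POMDP with log-linear models as in part (A) of the context, with $\kappa_P,\kappa_\Phi\in(0,1]$ and $\alpha:=(1-\kappa_P)(4-3\kappa_\Phi)<1$. Fix a horizon $T\in\mathbb N$, $T\ge1$, a fixed action sequence, and $\Theta=(\theta,w)$ with $\|\Theta-\Theta^\star\|_2\le r_\Theta$, $\|\theta-\theta^\star\|_2\le\delta(\theta)$ and $\|w-w^\star\|_2\le\delta(w)$. Let $(b_t^\Theta)$, $(b_t^{\Theta^\star})$ be the belief processes under $\Theta$, $\Theta^\star$ on the same observations and actions, both started at $\nu_0$, with observations generated under the true model $\Theta^\star$. For $t=0,\dots,T-1$ let $X_t:=\|b_t^\Theta-b_t^{\Theta^\star}\|_{\mathrm{TV}}$, and let $\mathcal F_t^-:=\sigma(\hat s_{1:t},a_{0:t-1})$, $\mathcal F_t:=\sigma(\hat s_{1:t},a_{0:t})$, with $\mathcal F_{-1}^-$ trivial. Then $X_t$ is $\mathcal F_t^-$-measurable, and for any $\delta_b\in(0,1)$, with probability at least $1-\delta_b$, $$\frac1T\sum_{t=0}^{T-1}X_t\le\frac{2c_b}{1-\alpha}+\frac{2}{1-\alpha}\sqrt{\frac{2c_b\log(1/\delta_b)}{T}}+\frac{\log(1/\delta_b)}{T(1-\alpha)}\Big(\frac43+\frac{2\alpha}{1-\alpha}\Big),$$ where $c_b=c_b(\delta(\theta),\delta(w)):=B\big(\delta(w)+\frac{3-2\kappa_\Phi}{2}\delta(\theta)\big)$. (Neural-softmax model.) The same holds for the neural-softmax model of part (B) of the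 context. That is, let $W,W^\star\in\mathcal D$ with $W^\star$ the true parameter, let $\delta_{\mathrm{NN}}\in(0,1)$, $X_t^{\mathrm{NN}}:=\|b_t^W-b_t^{W^\star}\|_{\mathrm{TV}}$ (observations generated under $W^\star$, both beliefs started at $\nu_0$), and suppose $\alpha_{\mathrm{NN}}:=(1-\kappa_P^{\mathrm{NN}})(4-3\kappa_\Phi^{\mathrm{NN}})<1$. Then for any $\delta_b\in(0,1)$, on the event $\mathcal E^{\mathrm{NN}}_{\mathrm{lin}}(\delta_{\mathrm{NN}})$, with conditional probability at least $1-\delta_b$, and hence with joint probability (over initialization and observations) at least $1-(\delta_b+\delta_{\mathrm{NN}})$, $$\frac1T\sum_{t=0}^{T-1}X_t^{\mathrm{NN}}\le\frac{2c_b^{\mathrm{NN}}}{1-\alpha_{\mathrm{NN}}}+\frac{2}{1-\alpha_{\mathrm{NN}}}\sqrt{\frac{2c_b^{\mathrm{NN}}\log(1/\delta_b)}{T}}+\frac{\log(1/\delta_b)}{T(1-\alpha_{\mathrm{NN}})}\Big(\frac43+\frac{2\alpha_{\mathrm{NN}}}{1-\alpha_{\mathrm{NN}}}\Big),$$ where $c_b^{\mathrm{NN}}:=B^{\mathrm{NN}}\|W_\Phi-W_\Phi^\star\|_F+2\varepsilon_\Phi^{\mathrm{NN}}(m,\delta_{\mathrm{NN}})+(3-2\kappa_\Phi^{\mathrm{NN}})\big(\frac{B^{\mathrm{NN}}}{2}\|W_p-W_p^\star\|_F+\varepsilon_p^{\mathrm{NN}}(m,\delta_{\mathrm{NN}}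)\big)$.
   Context: Common notation. $\mathbb S$ (latent states), $\hat{\mathbb S}$ (observations), $\mathbb A$ (actions) are finite nonempty sets; $\Delta_X$ is the set of probability vectors on $X$; $\|\mu-\nu\|_{\mathrm{TV}}=\frac12\|\mu-\nu\|_1$; $\nu_0\in\Delta_{\mathbb S}$ is the known initial distribution. For a transition kernel $P$ and observation model $\Phi$, the belief process is $b_0=\nu_0$, $b_{k+1}(s')\propto\Phi(\hat s_{k+1}\mid s')\sum_sP(s'\mid s,a_k)b_k(s)$, normalized over $s'\in\mathbb S$; $b^\Theta$ uses $(P_\theta,\Phi_w)$ and $b^W$ uses $(P_{W_p},\Phi_{W_\Phi})$. "Generated under the true model" with fixed actions $a_0,a_1,\dots$ means $s_0\sim\nu_0$, $s_{k+1}\sim P^{\rm true}(\cdot\mid s_k,a_k)$, $\hat s_k\sim\Phi^{\rm true}(\cdot\mid s_k)$ for $k\ge1$. (A) Log-linear model. For $\theta\in\mathbb R^{d_\theta}$, $w\in\mathbb R^{d_w}$, $$P_\theta(s'\mid s,a)=\frac{\exp\{\theta^\top\phi_p(s,a,s')\}}{\sum_{\bar s\in\mathbb S}\exp\{\theta^\top\phi_p(s,a,\bar s)\}},\qquad \Phi_w(\hat s\mid s)=\frac{\exp\{w^\top\phi_\Phi(s,\hat s)\}}{\sum_{\bar s\in\hat{\mathbb S}}\exp\{w^\top\phi_\Phi(s,\bar s)\}},$$ with $\|\phi_p(s,a,s')\|_2\le B$, $\|\phi_\Phi(s,\hat s)\|_2\le B$ for all arguments, $B<\infty$; $1>\nu_{\max}\ge\nu_0(s)\ge\nu_{\min}>0$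 for all $s$. The true parameter is $\Theta^\star=(\theta^\star,w^\star)$; feasible set $\{\Theta:\|\Theta-\Theta^\star\|_2\le r_\Theta\}$ with $r_\Theta>0$. Dobrushin coefficients (infima over feasible $(\theta,w)$): $$\kappa_P:=\inf_\theta\inf_{s,s',a}\sum_{x\in\mathbb S}\min\{P_\theta(x\mid s,a),P_\theta(x\mid s',a)\},\qquad \kappa_\Phi:=\inf_w\inf_{s,s'}\sum_{\hat s\in\hat{\mathbb S}}\min\{\Phi_w(\hat s\mid s),\Phi_w(\hat s\mid s')\}.$$ (B) Neural-softmax model. $\|\cdot\|_F$, $\langle\cdot,\cdot\rangle_F$: Frobenius norm and inner product. Let $m$ be even, $x_p(s,a,s')\in\mathbb R^{d_{x,p}}$, $x_\Phi(s,\hat s)\in\mathbb R^{d_{x,\Phi}}$ fixed encodings. For $W_p=(\omega_{p,i})_{i\le m}\in\mathbb R^{m\times d_{x,p}}$, $W_\Phi=(\omega_{\Phi,i})_{i\le m}\in\mathbb R^{m\times d_{x,\Phi}}$ and fixed signs $c_{p,i},c_{\Phi,i}\in\{-1,1\}$: $$F_p(s,a,s';W_p)=\frac1{\sqrt m}\sum_{i=1}^mc_{p,i}\,\mathrm{ReLU}(\omega_{p,i}^\top x_p(s,a,s')),\quad F_\Phi(s,\hat s;W_\Phi)=\frac1{\sqrt m}\sum_{i=1}^mc_{\Phi,i}\,\mathrm{ReLU}(\omega_{\Phi,i}^\top x_\Phi(s,\hat s)),$$ $P_{W_p}(s'\mid s,a)=e^{F_p(s,a,s';W_p)}/\sum_{\bar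 s\in\mathbb S}e^{F_p(s,a,\bar s;W_p)}$, $\Phi_{W_\Phi}(\hat s\mid s)=e^{F_\Phi(s,\hat s;W_\Phi)}/\sum_{\bar s\in\hat{\mathbb S}}e^{F_\Phi(s,\bar s;W_\Phi)}$. Symmetric random initialization: for $g\in\{p,\Phi\}$, $i\le m/2$, independently $c_{g,i}$ Rademacher and $\omega_{g,i,0}\sim\mathcal N(0,I_{d_{x,g}})$; $c_{g,i+m/2}=-c_{g,i}$, $\omega_{g,i+m/2,0}=\omega_{g,i,0}$; $W_{g,0}=(\omega_{g,i,0})_{i\le m}$ (so scores vanish at initialization). Tangent features $\phi_p^{\mathrm{NN}}:=\nabla_{W_p}F_p(\cdot;W_{p,0})$, $\phi_\Phi^{\mathrm{NN}}:=\nabla_{W_\Phi}F_\Phi(\cdot;W_{\Phi,0})$ (fixed convention for $\mathrm{ReLU}'(0)\in[0,1]$), assumed bounded in Frobenius norm by $B^{\mathrm{NN}}<\infty$ uniformly over arguments. Linearized scores $F^{\mathrm{lin}}_{p,W_p}=F_p(\cdot;W_{p,0})+\langle\phi_p^{\mathrm{NN}},W_p-W_{p,0}\rangle_F$, $F^{\mathrm{lin}}_{\Phi,W_\Phi}=F_\Phi(\cdot;W_{\Phi,0})+\langle\phi_\Phi^{\mathrm{NN}},W_\Phi-W_{\Phi,0}\rangle_F$. $\mathcal D=\mathcal D_p\times\mathcal D_\Phi$ is a bounded convex neighborhood of the initialization containing $W^\star=(W_p^\star,W_\Phi^\star)$, whose kernels $P_{W_p^\star},\Phi_{W_\Phi^\star}$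 are those of the true POMDP. $\mathcal E^{\mathrm{NN}}_{\mathrm{lin}}(\delta_{\mathrm{NN}})$ is the event (over the initialization) that $\sup_{W_p\in\mathcal D_p}\sup_{s,a,s'}|F_p(s,a,s';W_p)-F^{\mathrm{lin}}_{p,W_p}(s,a,s')|\le\varepsilon_p^{\mathrm{NN}}(m,\delta_{\mathrm{NN}})$ and $\sup_{W_\Phi\in\mathcal D_\Phi}\sup_{s,\hat s}|F_\Phi(s,\hat s;W_\Phi)-F^{\mathrm{lin}}_{\Phi,W_\Phi}(s,\hat s)|\le\varepsilon_\Phi^{\mathrm{NN}}(m,\delta_{\mathrm{NN}})$; $\mathcal D$ and the levels $\varepsilon^{\mathrm{NN}}_p,\varepsilon^{\mathrm{NN}}_\Phi\ge0$ are such that its probability is at least $1-\delta_{\mathrm{NN}}$. Neural Dobrushin coefficients: $$\kappa_P^{\mathrm{NN}}:=\inf_{W_p\in\mathcal D_p}\inf_{a,s,s''}\sum_{x\in\mathbb S}\min\{P_{W_p}(x\mid s,a),P_{W_p}(x\mid s'',a)\},\quad \kappa_\Phi^{\mathrm{NN}}:=\inf_{W_\Phi\in\mathcal D_\Phi}\inf_{s,s''}\sum_{\hat s\in\hat{\mathbb S}}\min\{\Phi_{W_\Phi}(\hat s\mid s),\Phi_{W_\Phi}(\hat s\mid s'')\}.$$ *)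

theory Defs
  imports "HOL-Probability.Probability"
begin

section \<open>Finite POMDPs with a fixed action sequence\<close>

text \<open>
  Latent states \<open>'s\<close>, observations \<open>'o\<close> and actions \<open>'a\<close> are finite types.  A transition kernel is
  written \<open>P s a s'\<close> for \<open>P(s' | s, a)\<close> and an observation model \<open>\<Phi> s y\<close> for \<open>\<Phi>(y | s)\<close>.
\<close>

definition prob_vector :: "('x::finite \<Rightarrow> real) \<Rightarrow> bool" where
  "prob_vector \<nu> \<longleftrightarrow> (\<forall>x. 0 \<le> \<nu> x) \<and> (\<Sum>x\<in>UNIV. \<nu> x) = 1"

definition tv_dist :: "('x::finite \<Rightarrow> real) \<Rightarrow> ('x \<Rightarrow> real) \<Rightarrow> real" where
  "tv_dist \<mu> \<nu> = (1/2) * (\<Sum>x\<in>UNIV. \<bar>\<mu> x - \<nu> x\<bar>)"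

primrec belief ::
  "('s::finite \<Rightarrow> real) \<Rightarrow> ('s \<Rightarrow> 'a \<Rightarrow> 's \<Rightarrow> real) \<Rightarrow> ('s \<Rightarrow> 'o \<Rightarrow> real) \<Rightarrow> (nat \<Rightarrow> 'a) \<Rightarrow> (nat \<Rightarrow> 'o)
    \<Rightarrow> nat \<Rightarrow> 's \<Rightarrow> real" where
  "belief \<nu>0 P \<Phi> act y 0 = \<nu>0"
| "belief \<nu>0 P \<Phi> act y (Suc k) =
    (\<lambda>s'. \<Phi> s' (y (Suc k)) * (\<Sum>s\<in>UNIV. P s (act k) s' * belief \<nu>0 P \<Phi> act y k s)
        / (\<Sum>s''\<in>UNIV. \<Phi> s'' (y (Suc k)) * (\<Sum>s\<in>UNIV. P s (act k) s'' * belief \<nu>0 P \<Phi> act y k s)))"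

text \<open>
  The processes \<open>S\<close> and \<open>Y\<close> on the probability space \<open>M\<close> satisfy \<open>S 0 \<sim> \<nu>0\<close>,
  \<open>S (k+1) \<sim> P(\<cdot> | S k, act k)\<close> and, for \<open>k \<ge> 1\<close>, \<open>Y k \<sim> \<Phi>(\<cdot> | S k)\<close>, each draw being conditionally
  independent of the past; this is expressed by the finite-dimensional joint laws.
  There is no observation at time 0, so \<open>Y 0\<close> is unconstrained.
\<close>

definition generated_under ::
  "('s::finite \<Rightarrow> real) \<Rightarrow> ('s \<Rightarrow> 'a \<Rightarrow> 's \<Rightarrow> real) \<Rightarrow> ('s \<Rightarrow> 'o::finite \<Rightarrow> real) \<Rightarrow> (nat \<Rightarrow> 'a)
    \<Rightarrow> 'm measure \<Rightarrow> (nat \<Rightarrow> 'm \<Rightarrow> 's) \<Rightarrow> (nat \<Rightarrow> 'm \<Rightarrow> 'o) \<Rightarrow> bool" where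
  "generated_under \<nu>0 P \<Phi> act M S Y \<longleftrightarrow>
     prob_space M \<and>
     (\<forall>k. S k \<in> measurable M (count_space UNIV)) \<and>
     (\<forall>k\<ge>1. Y k \<in> measurable M (count_space UNIV)) \<and>
     (\<forall>n s y. measure M {x \<in> space M. (\<forall>k\<le>n. S k x = s k) \<and> (\<forall>k\<in>{1..n}. Y k x = y k)}
        = \<nu>0 (s 0) * (\<Prod>k<n. P (s k) (act k) (s (Suc k)) * \<Phi> (s (Suc k)) (y (Suc k))))"

text \<open>
  The sigma-algebra generated by the first \<open>i\<close> observations \<open>Y 1, \<dots>, Y i\<close> and the first \<open>j\<close> actions
  \<open>act 0, \<dots>, act (j-1)\<close>, the latter viewed as constant random variables.  Thus \<open>\<F>\<^sub>t\<^sup>-\<close> is obtained for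
  \<open>i = j = t\<close>, \<open>\<F>\<^sub>t\<close> for \<open>i = t\<close>, \<open>j = t + 1\<close>, and the trivial sigma-algebra for \<open>i = j = 0\<close>.
\<close>

definition history_sigma ::
  "'m measure \<Rightarrow> (nat \<Rightarrow> 'a) \<Rightarrow> (nat \<Rightarrow> 'm \<Rightarrow> 'o) \<Rightarrow> nat \<Rightarrow> nat \<Rightarrow> 'm measure" where
  "history_sigma M act Y i j =
     sigma (space M)
       ({Y k -` A \<inter> space M | k A. k \<in> {1..i}} \<union> {(\<lambda>_. act k) -` A \<inter> space M | k A. k < j})"

text \<open>Uniform Dobrushin coefficients of a set of transition kernels and of observation models.\<close>

definition dobrushin_trans :: "('s::finite \<Rightarrow> 'a::finite \<Rightarrow> 's \<Rightarrow> real) set \<Rightarrow> real" where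
  "dobrushin_trans \<P> = (INF P\<in>\<P>. INF (s, s', a)\<in>UNIV. \<Sum>x\<in>UNIV. min (P s a x) (P s' a x))"

definition dobrushin_obs :: "('s::finite \<Rightarrow> 'o::finite \<Rightarrow> real) set \<Rightarrow> real" where
  "dobrushin_obs \<Q> = (INF \<Phi>\<in>\<Q>. INF (s, s')\<in>UNIV. \<Sum>y\<in>UNIV. min (\<Phi> s y) (\<Phi> s' y))"

definition softmax :: "('x::finite \<Rightarrow> real) \<Rightarrow> 'x \<Rightarrow> real" where
  "softmax f x = exp (f x) / (\<Sum>z\<in>UNIV. exp (f z))"

definition avg_belief_bound :: "real \<Rightarrow> real \<Rightarrow> real \<Rightarrow> nat \<Rightarrow> real" where
  "avg_belief_bound c \<alpha> \<delta> T =
     2 * c / (1 - \<alpha>)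
     + 2 / (1 - \<alpha>) * sqrt (2 * c * ln (1 / \<delta>) / real T)
     + ln (1 / \<delta>) / (real T * (1 - \<alpha>)) * (4/3 + 2 * \<alpha> / (1 - \<alpha>))"

section \<open>Log-linear models\<close>

definition loglin_trans ::
  "('s::finite \<Rightarrow> 'a \<Rightarrow> 's \<Rightarrow> real ^ 'd) \<Rightarrow> real ^ 'd \<Rightarrow> 's \<Rightarrow> 'a \<Rightarrow> 's \<Rightarrow> real" where
  "loglin_trans \<phi> \<theta> s a = softmax (\<lambda>s'. \<theta> \<bullet> \<phi> s a s')"

definition loglin_obs ::
  "('s \<Rightarrow> 'o::finite \<Rightarrow> real ^ 'd) \<Rightarrow> real ^ 'd \<Rightarrow> 's \<Rightarrow> 'o \<Rightarrow> real" where
  "loglin_obs \<phi> w s = softmax (\<lambda>y. w \<bullet> \<phi> s y)"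

section \<open>Neural-softmax models\<close>

text \<open>
  An \<open>m \<times> d\<close> weight matrix is an element of \<open>real ^ 'd ^ 'm\<close> with \<open>m = CARD('m)\<close>; the library's \<open>norm\<close>
  and \<open>\<bullet>\<close> on this type are the Frobenius norm and inner product.
\<close>

definition relu :: "real \<Rightarrow> real" where
  "relu z = max 0 z"

text \<open>The parameter \<open>r\<close> is the value chosen for the derivative at 0.\<close>

definition relu_deriv :: "real \<Rightarrow> real \<Rightarrow> real" where
  "relu_deriv r z = (if z > 0 then 1 else if z < 0 then 0 else r)"

definition nn_score :: "('m::finite \<Rightarrow> real) \<Rightarrow> real ^ 'd ^ 'm \<Rightarrow> real ^ 'd \<Rightarrow> real" where
  "nn_score c W x = (1 / sqrt (real CARD('m))) * (\<Sum>i\<in>UNIV. c i * relu (W $ i \<bullet> x))"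

text \<open>The gradient of \<open>nn_score c W x\<close> in \<open>W\<close>, with the above convention at the kinks.\<close>

definition nn_feature ::
  "real \<Rightarrow> ('m::finite \<Rightarrow> real) \<Rightarrow> real ^ 'd \<Rightarrow> real ^ 'd ^ 'm \<Rightarrow> real ^ 'd ^ 'm" where
  "nn_feature r c x W =
     (\<chi> i. (1 / sqrt (real CARD('m)) * c i * relu_deriv r (W $ i \<bullet> x)) *\<^sub>R x)"

definition nn_lin_score ::
  "real \<Rightarrow> ('m::finite \<Rightarrow> real) \<Rightarrow> real ^ 'd ^ 'm \<Rightarrow> real ^ 'd ^ 'm \<Rightarrow> real ^ 'd \<Rightarrow> real" where
  "nn_lin_score r c W0 W x = nn_score c W0 x + nn_feature r c x W0 \<bullet> (W - W0)"

definition nn_trans ::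
  "('s::finite \<Rightarrow> 'a \<Rightarrow> 's \<Rightarrow> real ^ 'd) \<Rightarrow> ('m::finite \<Rightarrow> real) \<Rightarrow> real ^ 'd ^ 'm
    \<Rightarrow> 's \<Rightarrow> 'a \<Rightarrow> 's \<Rightarrow> real" where
  "nn_trans enc c W s a = softmax (\<lambda>s'. nn_score c W (enc s a s'))"

definition nn_obs ::
  "('s \<Rightarrow> 'o::finite \<Rightarrow> real ^ 'd) \<Rightarrow> ('m::finite \<Rightarrow> real) \<Rightarrow> real ^ 'd ^ 'm \<Rightarrow> 's \<Rightarrow> 'o \<Rightarrow> real" where
  "nn_obs enc c W s = softmax (\<lambda>y. nn_score c W (enc s y))"

subsection \<open>Symmetric random initialization\<close>

text \<open>
  The even width \<open>m\<close> is \<open>2 * CARD('h)\<close>: the neurons are indexed by \<open>'h + 'h\<close>, where \<open>Inl i\<close> stands for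
  a neuron of the first half and \<open>Inr i\<close> for its partner \<open>i + m/2\<close>.  The outcome of the random
  initialization of one network assigns to each \<open>i :: 'h\<close> the pair of its sign and its weight vector.
\<close>

definition rademacher :: "real measure" where
  "rademacher = uniform_count_measure {-1, 1}"

definition std_gaussian :: "(real ^ 'd) measure" where
  "std_gaussian =
     distr (Pi\<^sub>M UNIV (\<lambda>_. density lborel (\<lambda>z. ennreal (std_normal_density z)))) borel (\<lambda>g. \<chi> i. g i)"

type_synonym ('h, 'd) net_init = "'h \<Rightarrow> real \<times> (real ^ 'd)"

definition net_init_measure :: "('h::finite, 'd::finite) net_init measure" where
  "net_init_measure = Pi\<^sub>M UNIV (\<lambda>_. rademacher \<Otimes>\<^sub>M std_gaussian)"

definition init_signs :: "('h, 'd::finite) net_init \<Rightarrow> 'h + 'h \<Rightarrow> real" where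
  "init_signs \<eta> = case_sum (\<lambda>i. fst (\<eta> i)) (\<lambda>i. - fst (\<eta> i))"

definition init_weights :: "('h::finite, 'd::finite) net_init \<Rightarrow> real ^ 'd ^ ('h + 'h)" where
  "init_weights \<eta> = (\<chi> j. case_sum (\<lambda>i. snd (\<eta> i)) (\<lambda>i. snd (\<eta> i)) j)"

text \<open>The two networks (transition, observation) are initialized independently.\<close>

definition init_measure ::
  "(('h::finite, 'dp::finite) net_init \<times> ('h, 'do::finite) net_init) measure" where
  "init_measure = net_init_measure \<Otimes>\<^sub>M net_init_measure"

text \<open>
  Outcomes for which the linearization error, uniformly over the (possibly outcome-dependent) sets
  \<open>Dp\<close> and \<open>Do\<close>, is at most \<open>ep\<close> respectively \<open>eo\<close>.
\<close>

definition lin_event ::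
  "real \<Rightarrow> ('s \<Rightarrow> 'a \<Rightarrow> 's \<Rightarrow> real ^ 'dp) \<Rightarrow> ('s \<Rightarrow> 'o \<Rightarrow> real ^ 'do)
    \<Rightarrow> (('h::finite, 'dp::finite) net_init \<times> ('h, 'do::finite) net_init \<Rightarrow> (real ^ 'dp ^ ('h + 'h)) set)
    \<Rightarrow> (('h, 'dp) net_init \<times> ('h, 'do) net_init \<Rightarrow> (real ^ 'do ^ ('h + 'h)) set)
    \<Rightarrow> real \<Rightarrow> real \<Rightarrow> (('h, 'dp) net_init \<times> ('h, 'do) net_init) set" where
  "lin_event r xp xo Dp Do ep eo =
     {\<omega> \<in> space init_measure.
       (\<forall>W\<in>Dp \<omega>. \<forall>s a s'.
          \<bar>nn_score (init_signs (fst \<omega>)) W (xp s a s')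
            - nn_lin_score r (init_signs (fst \<omega>)) (init_weights (fst \<omega>)) W (xp s a s')\<bar> \<le> ep) \<and>
       (\<forall>W\<in>Do \<omega>. \<forall>s y.
          \<bar>nn_score (init_signs (snd \<omega>)) W (xo s y)
            - nn_lin_score r (init_signs (snd \<omega>)) (init_weights (snd \<omega>)) W (xo s y)\<bar> \<le> eo)}"

text \<open>
  Measurability of a random set in the usual (Effros) sense.  It makes infima of continuous functions
  over the random set, in particular the Dobrushin coefficients, random variables.
\<close>

definition random_set :: "'w measure \<Rightarrow> ('w \<Rightarrow> 'v::topological_space set) \<Rightarrow> bool" where
  "random_set N D \<longleftrightarrow> (\<forall>U. open U \<longrightarrow> {\<omega> \<in> space N. D \<omega> \<inter> U \<noteq> {}} \<in> sets N)"

end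

theory Submission
  imports Defs
begin

text \<open>
  Why the bound holds.  Write \<open>X\<^sub>t\<close> for the total variation distance of the two beliefs, \<open>\<kappa>\<^sub>P\<close>, \<open>\<kappa>\<^sub>\<Phi>\<close> for the
  overlaps of the assumed kernels, and \<open>e\<^sub>P\<close>, \<open>e\<^sub>\<Phi>\<close> for the total variation errors of the assumed kernels.
  
  One filter step.  Prediction contracts by Dobrushin's theorem: the predictions \<open>p\<close>, \<open>p'\<close> satisfy
  \<open>TV(p, p') \<le> (1 - \<kappa>\<^sub>P) X\<^sub>t + e\<^sub>P\<close>.  Bayes' rule can expand distances for a particular observation, but not much
  on average: the mean of \<open>TV\<close> between the posteriors, weighted with the true observation law, is at most the
  distance of the joint laws of (state, observation) plus the distance of the two observation marginals, hence
  at most \<open>(2 - \<kappa>\<^sub>\<Phi>) TV(p, p') + 2 e\<^sub>\<Phi>\<close>.  As \<open>\<kappa>\<^sub>\<Phi> \<le> 1\<close>, this gives \<open>E[X\<^sub>t\<^sub>+\<^sub>1 | past] \<le> \<alpha> X\<^sub>t + c\<close> with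
  \<open>\<alpha> = (1 - \<kappa>\<^sub>P)(4 - 3 \<kappa>\<^sub>\<Phi>)\<close> and \<open>c = 2 e\<^sub>\<Phi> + (3 - 2 \<kappa>\<^sub>\<Phi>) e\<^sub>P\<close> (\<open>expected_err_step\<close>).
  
  Concentration.  Since \<open>0 \<le> X \<le> 1\<close>, convexity gives \<open>exp (l X) \<le> 1 + (exp l - 1) X\<close>, so the product of the factors
  \<open>exp (l X\<^sub>k\<^sub>+\<^sub>1 - (exp l - 1)(\<alpha> X\<^sub>k + c))\<close> is a supermartingale starting at 1.  Markov's inequality bounds
  \<open>l \<Sum>X\<close> by \<open>(exp l - 1)(\<alpha> \<Sum>X + c T) + ln (1/\<delta>)\<close> with probability at least \<open>1 - \<delta>\<close>.  The conditional variance is itself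
  controlled by \<open>X\<close>, which is why \<open>\<Sum>X\<close> occurs on both sides; with \<open>exp l - 1 \<le> l (1 + \<psi>)\<close> and \<open>\<psi> \<alpha> \<le> (1 - \<alpha>)/2\<close>
  half of the gap \<open>1 - \<alpha>\<close> absorbs it, and optimizing \<open>\<psi>\<close> under this constraint produces the bound
  (\<open>exists_bernstein_parameter\<close>, \<open>average_error_concentration\<close>).
  
  The two models.  If two score functions differ by at most \<open>e\<close>, their softmax laws differ by at most \<open>e/2\<close> in
  total variation (\<open>tv_dist_softmax_le\<close>).  For log-linear scores \<open>e\<close> is given by Cauchy-Schwarz.  For neural
  scores one compares both networks with their linearization at the initialization, which costs twice the
  linearization error.  The joint statement integrates the conditional one over the
  initialization; its substance is that all quantities are jointly measurable.
\<close>

section \<open>Total variation and Dobrushin contraction\<close>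

lemma tv_dist_nonneg: "0 \<le> tv_dist \<mu> \<nu>"
  by (simp add: tv_dist_def sum_nonneg)

lemma tv_dist_triangle: "tv_dist \<mu> \<rho> \<le> tv_dist \<mu> \<nu> + tv_dist \<nu> \<rho>"
proof -
  have "(\<Sum>x\<in>UNIV. \<bar>\<mu> x - \<rho> x\<bar>) \<le> (\<Sum>x\<in>UNIV. \<bar>\<mu> x - \<nu> x\<bar> + \<bar>\<nu> x - \<rho> x\<bar>)"
    by (rule sum_mono) linarith
  then show ?thesis by (simp add: tv_dist_def sum.distrib)
qed

lemma tv_dist_le_1:
  assumes "prob_vector \<mu>" "prob_vector \<nu>"
  shows "tv_dist \<mu> \<nu> \<le> 1"
proof -
  have "(\<Sum>x\<in>UNIV. \<bar>\<mu> x - \<nu> x\<bar>) \<le> (\<Sum>x\<in>UNIV. \<mu> x + \<nu> x)"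
  proof (rule sum_mono)
    fix x show "\<bar>\<mu> x - \<nu> x\<bar> \<le> \<mu> x + \<nu> x"
      using assms[unfolded prob_vector_def, THEN conjunct1, rule_format, of x] by linarith
  qed
  then show ?thesis using assms by (simp add: tv_dist_def sum.distrib prob_vector_def)
qed

lemma tv_dist_eq_overlap:
  assumes "prob_vector \<mu>" "prob_vector \<nu>"
  shows "tv_dist \<mu> \<nu> = 1 - (\<Sum>x\<in>UNIV. min (\<mu> x) (\<nu> x))"
proof -
  have "\<bar>\<mu> x - \<nu> x\<bar> = \<mu> x + \<nu> x - 2 * min (\<mu> x) (\<nu> x)" for x by linarith
  then have "(\<Sum>x\<in>UNIV. \<bar>\<mu> x - \<nu> x\<bar>) = 2 - 2 * (\<Sum>x\<in>UNIV. min (\<mu> x) (\<nu> x))"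
    using assms by (simp add: sum.distrib sum_subtractf sum_distrib_left prob_vector_def)
  then show ?thesis by (simp add: tv_dist_def)
qed

lemma tv_dist_eq_positive_part:
  assumes "prob_vector \<mu>" "prob_vector \<nu>"
  shows "(\<Sum>x\<in>UNIV. max 0 (\<mu> x - \<nu> x)) = tv_dist \<mu> \<nu>"
proof -
  have "\<bar>\<mu> x - \<nu> x\<bar> = 2 * max 0 (\<mu> x - \<nu> x) - \<mu> x + \<nu> x" for x
    by (simp add: max_def abs_if)
  then have "(\<Sum>x\<in>UNIV. \<bar>\<mu> x - \<nu> x\<bar>) = 2 * (\<Sum>x\<in>UNIV. max 0 (\<mu> x - \<nu> x))"
    using assms by (simp add: sum.distrib sum_subtractf sum_distrib_left prob_vector_def)
  then show ?thesis by (simp add: tv_dist_def)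
qed

lemma tv_dist_commute: "tv_dist \<mu> \<nu> = tv_dist \<nu> \<mu>"
  by (simp add: tv_dist_def abs_minus_commute)

text \<open>
  The image of the weights \<open>b\<close> under the kernel \<open>K\<close>.  Both the prediction of the next state and the predictive
  law of the next observation have this form.
\<close>

definition push :: "('s::finite \<Rightarrow> 'x \<Rightarrow> real) \<Rightarrow> ('s \<Rightarrow> real) \<Rightarrow> 'x \<Rightarrow> real" where
  "push K b x = (\<Sum>s\<in>UNIV. K s x * b s)"

lemma prob_vector_push:
  assumes "\<And>s. prob_vector (K s)" "prob_vector b"
  shows "prob_vector (push K b)"
proof -
  have "(\<Sum>x\<in>UNIV. push K b x) = (\<Sum>s\<in>UNIV. (\<Sum>x\<in>UNIV. K s x) * b s)"
    unfolding push_def sum_distrib_right by (rule sum.swap)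
  then show ?thesis
    using assms by (auto simp: prob_vector_def push_def intro!: sum_nonneg)
qed

lemma tv_dist_push_le_kernel:
  assumes "prob_vector b" "\<And>s. tv_dist (K s) (K' s) \<le> e"
  shows "tv_dist (push K b) (push K' b) \<le> e"
proof -
  have "(\<Sum>x\<in>UNIV. \<bar>push K b x - push K' b x\<bar>) \<le> (\<Sum>x\<in>UNIV. \<Sum>s\<in>UNIV. \<bar>K s x - K' s x\<bar> * b s)"
  proof (rule sum_mono)
    fix x
    have "push K b x - push K' b x = (\<Sum>s\<in>UNIV. (K s x - K' s x) * b s)"
      by (simp add: push_def sum_subtractf left_diff_distrib)
    then have "\<bar>push K b x - push K' b x\<bar> \<le> (\<Sum>s\<in>UNIV. \<bar>(K s x - K' s x) * b s\<bar>)" by simp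
    then show "\<bar>push K b x - push K' b x\<bar> \<le> (\<Sum>s\<in>UNIV. \<bar>K s x - K' s x\<bar> * b s)"
      using assms(1) by (simp add: abs_mult prob_vector_def)
  qed
  also have "\<dots> = (\<Sum>s\<in>UNIV. (2 * tv_dist (K s) (K' s)) * b s)"
    by (subst sum.swap) (simp add: sum_distrib_right tv_dist_def)
  also have "\<dots> \<le> (\<Sum>s\<in>UNIV. (2 * e) * b s)"
    using assms by (intro sum_mono mult_right_mono) (auto simp: prob_vector_def)
  also have "\<dots> = 2 * e"
    using assms(1) by (simp add: prob_vector_def flip: sum_distrib_left)
  finally show ?thesis by (simp add: tv_dist_def)
qed

text \<open>
  Dobrushin's contraction.  The positive and the negative part \<open>u\<close>, \<open>v\<close> of \<open>b - b'\<close> have the same mass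
  \<open>\<tau> = TV(b, b')\<close>, so \<open>\<tau>\<close> times the difference of the images is an average over pairs \<open>(s, s')\<close>, with weight
  \<open>u s * v s'\<close>, of the differences of two rows of the kernel, each of which has norm at most \<open>2 (1 - \<kappa>)\<close>.
\<close>

lemma tv_dist_push_le_contraction:
  fixes K :: "'s::finite \<Rightarrow> 'x::finite \<Rightarrow> real"
  assumes K: "\<And>s. prob_vector (K s)"
    and overlap: "\<And>s s'. \<kappa> \<le> (\<Sum>x\<in>UNIV. min (K s x) (K s' x))"
    and b: "prob_vector b" "prob_vector b'"
  shows "tv_dist (push K b) (push K b') \<le> (1 - \<kappa>) * tv_dist b b'"
proof -
  define \<tau> where "\<tau> = tv_dist b b'"
  define u where "u s = max 0 (b s - b' s)" for s
  define v where "v s = max 0 (b' s - b s)" for s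
  have uv: "u s - v s = b s - b' s" "0 \<le> u s" "0 \<le> v s" for s
    by (auto simp: u_def v_def)
  have su: "sum u UNIV = \<tau>"
    using tv_dist_eq_positive_part[OF b] by (simp add: u_def \<tau>_def)
  have sv: "sum v UNIV = \<tau>"
    using tv_dist_eq_positive_part[OF b(2,1)] by (simp add: v_def \<tau>_def tv_dist_commute)
  have diff: "\<tau> * (push K b x - push K b' x) = (\<Sum>s\<in>UNIV. \<Sum>s'\<in>UNIV. u s * v s' * (K s x - K s' x))" for x
  proof -
    have "(\<Sum>s\<in>UNIV. \<Sum>s'\<in>UNIV. u s * v s' * (K s x - K s' x))
        = (\<Sum>s\<in>UNIV. \<Sum>s'\<in>UNIV. (u s * K s x) * v s') - (\<Sum>s\<in>UNIV. \<Sum>s'\<in>UNIV. u s * (v s' * K s' x))"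
      by (simp add: algebra_simps sum_subtractf)
    also have "\<dots> = (\<Sum>s\<in>UNIV. u s * K s x) * \<tau> - \<tau> * (\<Sum>s\<in>UNIV. v s * K s x)"
      by (simp add: su sv sum_product[symmetric])
    also have "\<dots> = \<tau> * (\<Sum>s\<in>UNIV. (u s - v s) * K s x)"
      by (simp add: algebra_simps sum_subtractf)
    also have "\<dots> = \<tau> * (push K b x - push K b' x)"
      by (simp add: uv push_def algebra_simps sum_subtractf)
    finally show ?thesis by simp
  qed
  have "\<tau> * (\<Sum>x\<in>UNIV. \<bar>push K b x - push K b' x\<bar>) = (\<Sum>x\<in>UNIV. \<bar>\<tau> * (push K b x - push K b' x)\<bar>)"
    using tv_dist_nonneg[of b b'] by (simp add: abs_mult sum_distrib_left \<tau>_def)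
  also have "\<dots> \<le> (\<Sum>x\<in>UNIV. \<Sum>s\<in>UNIV. \<Sum>s'\<in>UNIV. u s * v s' * \<bar>K s x - K s' x\<bar>)"
  proof (rule sum_mono)
    fix x
    show "\<bar>\<tau> * (push K b x - push K b' x)\<bar> \<le> (\<Sum>s\<in>UNIV. \<Sum>s'\<in>UNIV. u s * v s' * \<bar>K s x - K s' x\<bar>)"
      unfolding diff
      by (intro order_trans[OF sum_abs] sum_mono) (simp add: abs_mult uv)
  qed
  also have "\<dots> = (\<Sum>s\<in>UNIV. \<Sum>s'\<in>UNIV. u s * v s' * (\<Sum>x\<in>UNIV. \<bar>K s x - K s' x\<bar>))"
    unfolding sum_distrib_left by (subst sum.swap, intro sum.cong refl, rule sum.swap)
  also have "\<dots> \<le> (\<Sum>s\<in>UNIV. \<Sum>s'\<in>UNIV. u s * v s' * (2 * (1 - \<kappa>)))"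
  proof (intro sum_mono mult_left_mono)
    fix s s'
    show "(\<Sum>x\<in>UNIV. \<bar>K s x - K s' x\<bar>) \<le> 2 * (1 - \<kappa>)"
      using tv_dist_eq_overlap[OF K K, of s s'] overlap[of s s'] by (simp add: tv_dist_def)
  qed (simp add: uv)
  also have "\<dots> = \<tau> * \<tau> * (2 * (1 - \<kappa>))"
    unfolding sum_distrib_right[symmetric] by (simp add: su sv sum_product[symmetric])
  finally have main: "\<tau> * tv_dist (push K b) (push K b') \<le> \<tau> * ((1 - \<kappa>) * \<tau>)"
    by (simp add: tv_dist_def algebra_simps)
  show ?thesis
  proof (cases "\<tau> = 0")
    case True
    then have "b = b'" by (auto simp: \<tau>_def tv_dist_def sum_nonneg_eq_0_iff fun_eq_iff)
    then show ?thesis by (simp add: tv_dist_def)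
  next
    case False
    then have "\<tau> > 0" using tv_dist_nonneg[of b b'] by (simp add: \<tau>_def)
    then show ?thesis using main by (simp add: \<tau>_def)
  qed
qed

definition bayes :: "('s::finite \<Rightarrow> 'o \<Rightarrow> real) \<Rightarrow> ('s \<Rightarrow> real) \<Rightarrow> 'o \<Rightarrow> 's \<Rightarrow> real" where
  "bayes \<Phi> p y s = \<Phi> s y * p s / push \<Phi> p y"

lemma push_pos:
  assumes "\<And>s. 0 < \<Phi> s y" "prob_vector p"
  shows "0 < push \<Phi> p y"
proof -
  obtain s where "p s \<noteq> 0"
    using assms(2) by (force simp: prob_vector_def intro: ccontr)
  then have "0 < p s" using assms(2) by (simp add: prob_vector_def order_less_le)
  then show ?thesis
    unfolding push_def using assms
    by (intro sum_pos2[of _ s]) (auto simp: prob_vector_def less_imp_le)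
qed

lemma prob_vector_bayes:
  assumes "\<And>s. 0 < \<Phi> s y" "prob_vector p"
  shows "prob_vector (bayes \<Phi> p y)"
proof -
  have "0 < push \<Phi> p y" using assms by (rule push_pos)
  then show ?thesis
    using assms unfolding prob_vector_def bayes_def sum_divide_distrib[symmetric]
    by (auto simp: push_def less_imp_le)
qed

text \<open>
  Multiplying the posterior for \<open>y\<close> by the predictive probability \<open>m' y\<close> turns it into the joint law, except that
  the posterior under the assumed model carries the wrong normalization \<open>m y\<close>.  The correction costs
  \<open>\<bar>m y - m' y\<bar>\<close>, so only the distances of the joint laws and of the observation marginals enter; the overlap
  improves the latter by contraction.
\<close>

lemma expected_tv_dist_bayes_le:
  fixes \<Phi> \<Phi>' :: "'s::finite \<Rightarrow> 'o::finite \<Rightarrow> real"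
  assumes \<Phi>: "\<And>s. prob_vector (\<Phi> s)" "\<And>s y. 0 < \<Phi> s y"
    and \<Phi>': "\<And>s. prob_vector (\<Phi>' s)" "\<And>s y. 0 < \<Phi>' s y"
    and p: "prob_vector p" "prob_vector p'"
    and overlap: "\<And>s s'. \<kappa> \<le> (\<Sum>y\<in>UNIV. min (\<Phi> s y) (\<Phi> s' y))"
    and close: "\<And>s. tv_dist (\<Phi> s) (\<Phi>' s) \<le> e"
  shows "(\<Sum>y\<in>UNIV. push \<Phi>' p' y * tv_dist (bayes \<Phi> p y) (bayes \<Phi>' p' y))
      \<le> (2 - \<kappa>) * tv_dist p p' + 2 * e"
proof -
  let ?m = "push \<Phi> p" and ?m' = "push \<Phi>' p'"
  have joint: "?m' y * tv_dist (bayes \<Phi> p y) (bayes \<Phi>' p' y)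
      \<le> (1/2) * ((\<Sum>s\<in>UNIV. \<bar>\<Phi> s y * p s - \<Phi>' s y * p' s\<bar>) + \<bar>?m y - ?m' y\<bar>)" for y
  proof -
    have pos: "0 < ?m y" "0 < ?m' y" by (auto intro!: push_pos \<Phi> \<Phi>' p)
    have "?m' y * (\<Sum>s\<in>UNIV. \<bar>bayes \<Phi> p y s - bayes \<Phi>' p' y s\<bar>)
        = (\<Sum>s\<in>UNIV. ?m' y * \<bar>bayes \<Phi> p y s - bayes \<Phi>' p' y s\<bar>)" by (rule sum_distrib_left)
    also have "\<dots> \<le> (\<Sum>s\<in>UNIV. \<bar>\<Phi> s y * p s - \<Phi>' s y * p' s\<bar> + \<Phi> s y * p s * (\<bar>?m y - ?m' y\<bar> / ?m y))"
    proof (rule sum_mono)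
      fix s
      let ?j = "\<Phi> s y * p s" and ?j' = "\<Phi>' s y * p' s"
      have j: "0 \<le> ?j" using \<Phi>(2)[of s y] p by (simp add: prob_vector_def less_imp_le)
      have "?m' y * \<bar>bayes \<Phi> p y s - bayes \<Phi>' p' y s\<bar> = \<bar>?m' y * (bayes \<Phi> p y s - bayes \<Phi>' p' y s)\<bar>"
        using pos by (simp add: abs_mult)
      also have "?m' y * (bayes \<Phi> p y s - bayes \<Phi>' p' y s) = (?j - ?j') + ?j * ((?m' y - ?m y) / ?m y)"
        using pos by (simp add: bayes_def field_simps)
      also have "\<bar>(?j - ?j') + ?j * ((?m' y - ?m y) / ?m y)\<bar> \<le> \<bar>?j - ?j'\<bar> + \<bar>?j * ((?m' y - ?m y) / ?m y)\<bar>"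
        by (rule abs_triangle_ineq)
      also have "\<bar>?j * ((?m' y - ?m y) / ?m y)\<bar> = ?j * (\<bar>?m y - ?m' y\<bar> / ?m y)"
        using pos by (simp only: abs_mult[of ?j] abs_of_nonneg[OF j]) (simp add: abs_minus_commute)
      finally show "?m' y * \<bar>bayes \<Phi> p y s - bayes \<Phi>' p' y s\<bar>
          \<le> \<bar>?j - ?j'\<bar> + ?j * (\<bar>?m y - ?m' y\<bar> / ?m y)" .
    qed
    also have "\<dots> = (\<Sum>s\<in>UNIV. \<bar>\<Phi> s y * p s - \<Phi>' s y * p' s\<bar>) + \<bar>?m y - ?m' y\<bar>"
      unfolding sum.distrib sum_distrib_right[symmetric] using pos by (simp flip: push_def)
    finally show ?thesis by (simp add: tv_dist_def)
  qed
  have "(\<Sum>y\<in>UNIV. \<Sum>s\<in>UNIV. \<bar>\<Phi> s y * p s - \<Phi>' s y * p' s\<bar>)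
      \<le> (\<Sum>y\<in>UNIV. \<Sum>s\<in>UNIV. \<Phi> s y * \<bar>p s - p' s\<bar> + \<bar>\<Phi> s y - \<Phi>' s y\<bar> * p' s)"
  proof (intro sum_mono)
    fix y s
    have "\<Phi> s y * p s - \<Phi>' s y * p' s = \<Phi> s y * (p s - p' s) + (\<Phi> s y - \<Phi>' s y) * p' s"
      by (simp add: algebra_simps)
    then have "\<bar>\<Phi> s y * p s - \<Phi>' s y * p' s\<bar> \<le> \<bar>\<Phi> s y * (p s - p' s)\<bar> + \<bar>(\<Phi> s y - \<Phi>' s y) * p' s\<bar>"
      by (metis abs_triangle_ineq)
    then show "\<bar>\<Phi> s y * p s - \<Phi>' s y * p' s\<bar> \<le> \<Phi> s y * \<bar>p s - p' s\<bar> + \<bar>\<Phi> s y - \<Phi>' s y\<bar> * p' s"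
      using \<Phi>(2)[of s y] p(2) by (simp add: abs_mult prob_vector_def less_imp_le)
  qed
  also have "\<dots> = (\<Sum>s\<in>UNIV. (\<Sum>y\<in>UNIV. \<Phi> s y) * \<bar>p s - p' s\<bar> + (2 * tv_dist (\<Phi> s) (\<Phi>' s)) * p' s)"
    by (subst sum.swap) (simp add: sum.distrib sum_distrib_right tv_dist_def)
  also have "\<dots> \<le> (\<Sum>s\<in>UNIV. \<bar>p s - p' s\<bar> + (2 * e) * p' s)"
    using close p(2) \<Phi>(1) by (intro sum_mono) (simp add: prob_vector_def mult_right_mono)
  also have "\<dots> = 2 * tv_dist p p' + 2 * e"
    using p(2) by (simp add: sum.distrib tv_dist_def prob_vector_def flip: sum_distrib_left)
  finally have joint_tv: "(\<Sum>y\<in>UNIV. \<Sum>s\<in>UNIV. \<bar>\<Phi> s y * p s - \<Phi>' s y * p' s\<bar>) \<le> 2 * tv_dist p p' + 2 * e" .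
  have "tv_dist ?m ?m' \<le> tv_dist ?m (push \<Phi> p') + tv_dist (push \<Phi> p') ?m'"
    by (rule tv_dist_triangle)
  also have "\<dots> \<le> (1 - \<kappa>) * tv_dist p p' + e"
    by (intro add_mono tv_dist_push_le_contraction tv_dist_push_le_kernel \<Phi> p overlap close)
  finally have marginal_tv: "tv_dist ?m ?m' \<le> (1 - \<kappa>) * tv_dist p p' + e" .
  have "(\<Sum>y\<in>UNIV. ?m' y * tv_dist (bayes \<Phi> p y) (bayes \<Phi>' p' y))
      \<le> (\<Sum>y\<in>UNIV. (1/2) * ((\<Sum>s\<in>UNIV. \<bar>\<Phi> s y * p s - \<Phi>' s y * p' s\<bar>) + \<bar>?m y - ?m' y\<bar>))"
    by (rule sum_mono) (rule joint)
  also have "\<dots> = (1/2) * (\<Sum>y\<in>UNIV. \<Sum>s\<in>UNIV. \<bar>\<Phi> s y * p s - \<Phi>' s y * p' s\<bar>) + tv_dist ?m ?m'"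
    unfolding sum_distrib_left[symmetric] sum.distrib tv_dist_def by (simp add: field_simps)
  finally show ?thesis using joint_tv marginal_tv by (simp add: algebra_simps)
qed

section \<open>Lipschitz continuity of the softmax map\<close>

lemma softmax_pos: "0 < softmax f x"
  by (simp add: softmax_def sum_pos)

lemma prob_vector_softmax: "prob_vector (softmax f)"
proof -
  have "0 < (\<Sum>z\<in>UNIV. exp (f z))" by (simp add: sum_pos)
  then show ?thesis
    unfolding prob_vector_def softmax_def sum_divide_distrib[symmetric] by simp
qed

text \<open>
  The derivative of the logistic function is at most \<open>1/4\<close>.
\<close>

lemma logistic_diff_le:
  fixes x y :: real
  assumes "x \<le> y"
  shows "1 / (1 + exp (- y)) - 1 / (1 + exp (- x)) \<le> (y - x) / 4"
proof -
  let ?g = "\<lambda>z::real. z / 4 - 1 / (1 + exp (- z))"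
  have "?g x \<le> ?g y"
  proof (rule DERIV_nonneg_imp_nondecreasing[OF assms])
    fix z :: real
    have ne: "1 + exp (- z) > 0" by (simp add: add_pos_pos)
    have "(?g has_real_derivative (1/4 - exp (- z) / (1 + exp (- z))^2)) (at z)"
      using ne by (auto intro!: derivative_eq_intros simp: power2_eq_square field_simps)
    moreover have "exp (- z) / (1 + exp (- z))^2 \<le> 1/4"
    proof -
      have "0 \<le> (1 - exp (- z))^2" by simp
      then have "4 * exp (- z) \<le> (1 + exp (- z))^2" by (simp add: power2_eq_square algebra_simps)
      then show ?thesis using ne by (simp add: divide_le_eq)
    qed
    ultimately show "\<exists>D. (?g has_real_derivative D) (at z) \<and> 0 \<le> D" by force
  qed
  then show ?thesis by (simp add: field_simps)
qed

text \<open>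
  The total variation distance is the difference of the probabilities of the set \<open>A\<close> where the first law is
  larger.  Such a probability is the logistic function of the log-odds \<open>ln (U / V)\<close> of \<open>A\<close>, and changing the scores
  by \<open>e\<close> changes the log-odds by at most \<open>2 e\<close>.  Going through the log-odds is what yields the sharp constant \<open>1/2\<close>.
\<close>

lemma tv_dist_softmax_le:
  assumes "\<And>x. \<bar>f x - g x\<bar> \<le> e"
  shows "tv_dist (softmax f) (softmax g) \<le> e / 2"
proof -
  define A where "A = {x. softmax g x < softmax f x}"
  define U where "U h = (\<Sum>x\<in>A. exp (h x))" for h :: "'a \<Rightarrow> real"
  define V where "V h = (\<Sum>x\<in>-A. exp (h x))" for h :: "'a \<Rightarrow> real"
  have "0 \<le> \<bar>f undefined - g undefined\<bar>" by simp
  then have e: "0 \<le> e" using assms order_trans by blast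
  have Z: "(\<Sum>x\<in>UNIV. exp (h x)) = U h + V h" for h
    using sum.Int_Diff[of UNIV "\<lambda>x. exp (h x)" A] by (simp add: U_def V_def Compl_eq_Diff_UNIV)
  have "tv_dist (softmax f) (softmax g) = (\<Sum>x\<in>UNIV. max 0 (softmax f x - softmax g x))"
    by (simp add: tv_dist_eq_positive_part prob_vector_softmax)
  also have "\<dots> = (\<Sum>x\<in>A. softmax f x - softmax g x)"
    by (rule sum.mono_neutral_cong_right) (auto simp: A_def)
  also have "\<dots> = U f / (U f + V f) - U g / (U g + V g)"
    by (simp add: softmax_def sum_subtractf U_def Z[unfolded U_def] flip: sum_divide_distrib)
  finally have tv: "tv_dist (softmax f) (softmax g) = U f / (U f + V f) - U g / (U g + V g)" .
  show ?thesis
  proof (cases "A = {} \<or> - A = {}")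
    case True
    then have "tv_dist (softmax f) (softmax g) \<le> 0"
    proof
      assume "A = {}" then show ?thesis by (simp add: tv U_def)
    next
      assume A: "- A = {}"
      have "U h > 0" for h using A unfolding U_def by (intro sum_pos) auto
      moreover have "V h = 0" for h using A by (simp add: V_def)
      ultimately show ?thesis by (simp add: tv less_imp_neq[symmetric])
    qed
    then show ?thesis using e by simp
  next
    case False
    have pos: "0 < U h" "0 < V h" for h using False unfolding U_def V_def by (auto intro!: sum_pos)
    have logistic: "U h / (U h + V h) = 1 / (1 + exp (- ln (U h / V h)))" for h
      using pos[of h] by (simp add: exp_minus field_simps)
    have "U f \<le> exp e * U g"
      unfolding U_def sum_distrib_left
      using assms by (intro sum_mono) (simp add: abs_le_iff add.commute diff_le_eq flip: exp_add)
    moreover have "V g \<le> exp e * V f"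
      unfolding V_def sum_distrib_left
      using assms by (intro sum_mono) (simp add: abs_le_iff add.commute algebra_simps flip: exp_add)
    ultimately have "U f * V g \<le> (exp e * U g) * (exp e * V f)"
      using pos[of f] pos[of g] by (intro mult_mono) auto
    then have "U f / V f \<le> exp (2 * e) * (U g / V g)"
      using pos[of f] pos[of g] exp_double[of e] by (simp add: field_simps power2_eq_square)
    then have "ln (U f / V f) \<le> ln (exp (2 * e) * (U g / V g))"
      using pos[of f] pos[of g] by (intro iffD2[OF ln_le_cancel_iff]) auto
    then have odds: "ln (U f / V f) \<le> 2 * e + ln (U g / V g)"
      using pos[of f] pos[of g] by (simp add: ln_mult ln_div)
    have "U f / (U f + V f) \<le> 1 / (1 + exp (- (2 * e + ln (U g / V g))))"
      unfolding logistic using odds by (intro divide_left_mono mult_pos_pos add_pos_pos) auto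
    also have "\<dots> - 1 / (1 + exp (- ln (U g / V g))) \<le> (2 * e) / 4"
      using logistic_diff_le[of "ln (U g / V g)" "2 * e + ln (U g / V g)"] e by simp
    finally show ?thesis unfolding tv logistic[of g] by simp
  qed
qed

section \<open>Two filters on the same observations\<close>

lemma belief_Suc_eq_bayes:
  "belief \<nu>0 P \<Phi> act y (Suc k) = bayes \<Phi> (push (\<lambda>s. P s (act k)) (belief \<nu>0 P \<Phi> act y k)) (y (Suc k))"
  by (simp add: bayes_def push_def fun_eq_iff)

lemma belief_cong:
  assumes "\<And>k. 1 \<le> k \<Longrightarrow> k \<le> n \<Longrightarrow> y k = y' k"
  shows "belief \<nu>0 P \<Phi> act y n = belief \<nu>0 P \<Phi> act y' n"
  using assms by (induction n) (simp_all add: belief_Suc_eq_bayes del: belief.simps(2))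

lemma prob_vector_belief:
  assumes "prob_vector \<nu>0" "\<And>s a. prob_vector (P s a)" "\<And>s y. 0 < \<Phi> s y"
  shows "prob_vector (belief \<nu>0 P \<Phi> act y n)"
  using assms
  by (induction n) (simp_all add: belief_Suc_eq_bayes prob_vector_bayes prob_vector_push del: belief.simps(2))

text \<open>
  The kernels may depend on the sample point as well: this covers both a fixed pair of models, where only the
  observations are random, and a random initialization.
\<close>

lemma borel_measurable_belief:
  fixes Y :: "nat \<Rightarrow> 'n \<Rightarrow> 'o::finite"
  assumes Y: "\<And>k. 1 \<le> k \<Longrightarrow> k \<le> t \<Longrightarrow> Y k \<in> measurable N (count_space UNIV)"
    and P: "\<And>s a s'. (\<lambda>x. P x s a s') \<in> borel_measurable N"
    and \<Phi>: "\<And>s y. (\<lambda>x. \<Phi> x s y) \<in> borel_measurable N"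
  shows "(\<lambda>x. belief \<nu>0 (P x) (\<Phi> x) act (\<lambda>k. Y k x) t s) \<in> borel_measurable N"
  using Y
proof (induction t arbitrary: s)
  case (Suc t)
  note [measurable] = P
  have [measurable]: "(\<lambda>x. belief \<nu>0 (P x) (\<Phi> x) act (\<lambda>k. Y k x) t s) \<in> borel_measurable N" for s
    using Suc by simp
  have [measurable]: "(\<lambda>x. \<Phi> x s (Y (Suc t) x)) \<in> borel_measurable N" for s
    by (rule measurable_compose_countable[OF \<Phi>]) (use Suc.prems in auto)
  show ?case by simp measurable
qed simp

lemma borel_measurable_tv_dist:
  assumes [measurable]: "\<And>s. (\<lambda>x. f x s) \<in> borel_measurable N" "\<And>s. (\<lambda>x. g x s) \<in> borel_measurable N"
  shows "(\<lambda>x. tv_dist (f x) (g x)) \<in> borel_measurable N"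
  unfolding tv_dist_def by measurable

lemma borel_measurable_belief_error_history:
  "(\<lambda>x. tv_dist (belief \<nu>0 P \<Phi> act (\<lambda>k. Y k x) t) (belief \<nu>0' P' \<Phi>' act (\<lambda>k. Y k x) t))
     \<in> borel_measurable (history_sigma M act (Y :: nat \<Rightarrow> 'm \<Rightarrow> 'o::finite) t j)"
proof -
  let ?H = "history_sigma M act Y t j"
  let ?G = "{Y k -` A \<inter> space M | k A. k \<in> {1..t}} \<union> {(\<lambda>_. act k) -` A \<inter> space M | k A. k < j}"
  have G: "?G \<subseteq> Pow (space M)" by auto
  have "Y k \<in> measurable ?H (count_space UNIV)" if "1 \<le> k" "k \<le> t" for k
  proof (rule measurableI)
    fix A :: "'o set"
    have "Y k -` A \<inter> space M \<in> sigma_sets (space M) ?G" using that by (intro sigma_sets.Basic) auto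
    then show "Y k -` A \<inter> space ?H \<in> sets ?H"
      unfolding history_sigma_def by (simp only: sets_measure_of[OF G] space_measure_of[OF G])
  qed simp
  then show ?thesis by (intro borel_measurable_tv_dist borel_measurable_belief) auto
qed

lemma sets_obs_prefix:
  assumes "generated_under \<nu>0 P \<Phi> act M S Y"
  shows "{x \<in> space M. \<forall>k\<in>{1..n}. Y k x = y k} \<in> sets M"
proof (rule sets.sets_Collect_finite_All)
  fix k assume "k \<in> {1..n}"
  then have [measurable]: "Y k \<in> measurable M (count_space UNIV)"
    using assms by (simp add: generated_under_def)
  show "{x \<in> space M. Y k x = y k} \<in> sets M" by measurable
qed simp

text \<open>
  Primed kernels are those of the true model.  The overlap assumptions concern only the assumed
  model: distances of different beliefs are contracted by its kernels, and the kernels are exchanged afterwards.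
\<close>

locale two_filters =
  fixes \<nu>0 :: "'s::finite \<Rightarrow> real" and act :: "nat \<Rightarrow> 'a"
    and P P' :: "'s \<Rightarrow> 'a \<Rightarrow> 's \<Rightarrow> real" and \<Phi> \<Phi>' :: "'s \<Rightarrow> 'o::finite \<Rightarrow> real"
    and \<kappa>P \<kappa>O eP eO :: real
  assumes init: "prob_vector \<nu>0"
    and P: "\<And>s a. prob_vector (P s a)" and P': "\<And>s a. prob_vector (P' s a)"
    and \<Phi>: "\<And>s. prob_vector (\<Phi> s)" "\<And>s y. 0 < \<Phi> s y"
    and \<Phi>': "\<And>s. prob_vector (\<Phi>' s)" "\<And>s y. 0 < \<Phi>' s y"
    and overlap_P: "\<And>s s' a. \<kappa>P \<le> (\<Sum>x\<in>UNIV. min (P s a x) (P s' a x))"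
    and overlap_\<Phi>: "\<And>s s'. \<kappa>O \<le> (\<Sum>y\<in>UNIV. min (\<Phi> s y) (\<Phi> s' y))"
    and close_P: "\<And>s a. tv_dist (P s a) (P' s a) \<le> eP"
    and close_\<Phi>: "\<And>s. tv_dist (\<Phi> s) (\<Phi>' s) \<le> eO"
begin

definition rate :: real where "rate = (1 - \<kappa>P) * (4 - 3 * \<kappa>O)"

definition drift :: real where "drift = 2 * eO + (3 - 2 * \<kappa>O) * eP"

definition err :: "(nat \<Rightarrow> 'o) \<Rightarrow> nat \<Rightarrow> real" where
  "err y t = tv_dist (belief \<nu>0 P \<Phi> act y t) (belief \<nu>0 P' \<Phi>' act y t)"

text \<open>
  The true conditional law of observation \<open>Suc k\<close> given \<open>y 1, \<dots>, y k\<close>.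
\<close>

definition next_obs_prob :: "(nat \<Rightarrow> 'o) \<Rightarrow> nat \<Rightarrow> 'o \<Rightarrow> real" where
  "next_obs_prob y k = push \<Phi>' (push (\<lambda>s. P' s (act k)) (belief \<nu>0 P' \<Phi>' act y k))"

definition obs_prob :: "(nat \<Rightarrow> 'o) \<Rightarrow> nat \<Rightarrow> real" where
  "obs_prob y n = (\<Prod>k<n. next_obs_prob y k (y (Suc k)))"

lemma kappa_le_1: "\<kappa>P \<le> 1" "\<kappa>O \<le> 1"
proof -
  show "\<kappa>P \<le> 1"
    using overlap_P[of undefined undefined undefined] P[of undefined undefined] by (simp add: prob_vector_def)
  show "\<kappa>O \<le> 1"
    using overlap_\<Phi>[of undefined undefined] \<Phi>(1)[of undefined] by (simp add: prob_vector_def)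
qed

lemma close_nonneg: "0 \<le> eP" "0 \<le> eO"
  using order_trans[OF tv_dist_nonneg close_P] order_trans[OF tv_dist_nonneg close_\<Phi>] by auto

lemma rate_nonneg: "0 \<le> rate"
  unfolding rate_def using kappa_le_1 by simp

lemma drift_nonneg: "0 \<le> drift"
  unfolding drift_def using kappa_le_1 close_nonneg by simp

lemma prob_vector_beliefs:
  "prob_vector (belief \<nu>0 P \<Phi> act y t)" "prob_vector (belief \<nu>0 P' \<Phi>' act y t)"
  by (intro prob_vector_belief init P P' \<Phi>(2) \<Phi>'(2))+

lemma err_nonneg: "0 \<le> err y t"
  by (simp add: err_def tv_dist_nonneg)

lemma err_le_1: "err y t \<le> 1"
  by (simp add: err_def tv_dist_le_1 prob_vector_beliefs)

lemma err_0: "err y 0 = 0"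
  by (simp add: err_def tv_dist_def)

lemma err_cong: "(\<And>k. 1 \<le> k \<Longrightarrow> k \<le> t \<Longrightarrow> y k = y' k) \<Longrightarrow> err y t = err y' t"
  unfolding err_def by (simp add: belief_cong[of t y y'])

lemma prob_vector_next_obs: "prob_vector (next_obs_prob y k)"
  unfolding next_obs_prob_def by (intro prob_vector_push P' \<Phi>'(1) prob_vector_beliefs)

lemma next_obs_prob_pos: "0 < next_obs_prob y k z"
  unfolding next_obs_prob_def by (intro push_pos prob_vector_push P' \<Phi>'(2) prob_vector_beliefs)

lemma next_obs_prob_cong:
  "(\<And>j. 1 \<le> j \<Longrightarrow> j \<le> k \<Longrightarrow> y j = y' j) \<Longrightarrow> next_obs_prob y k = next_obs_prob y' k"
  unfolding next_obs_prob_def by (simp add: belief_cong[of k y y'])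

lemma obs_prob_nonneg: "0 \<le> obs_prob y n"
  unfolding obs_prob_def by (intro prod_nonneg) (simp add: next_obs_prob_pos less_imp_le)

lemma obs_prob_extend: "obs_prob (y(Suc n := z)) (Suc n) = obs_prob y n * next_obs_prob y n z"
proof -
  have "next_obs_prob (y(Suc n := z)) k = next_obs_prob y k" if "k \<le> n" for k
    using that by (intro next_obs_prob_cong) auto
  then show ?thesis by (simp add: obs_prob_def)
qed

text \<open>
  The drift inequality \<open>E[X\<^sub>k\<^sub>+\<^sub>1 | past] \<le> rate * X\<^sub>k + drift\<close>, with the expectation written as a finite sum over the
  next observation.
\<close>

lemma expected_err_step:
  "(\<Sum>z\<in>UNIV. next_obs_prob y k z * err (y(Suc k := z)) (Suc k)) \<le> rate * err y k + drift"
proof -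
  let ?b = "belief \<nu>0 P \<Phi> act y k" and ?b' = "belief \<nu>0 P' \<Phi>' act y k"
  let ?p = "push (\<lambda>s. P s (act k)) ?b" and ?p' = "push (\<lambda>s. P' s (act k)) ?b'"
  have "belief \<nu>0 P \<Phi> act (y(Suc k := z)) k = ?b" "belief \<nu>0 P' \<Phi>' act (y(Suc k := z)) k = ?b'" for z
    by (auto intro!: belief_cong)
  then have "err (y(Suc k := z)) (Suc k) = tv_dist (bayes \<Phi> ?p z) (bayes \<Phi>' ?p' z)" for z
    unfolding err_def belief_Suc_eq_bayes by simp
  then have "(\<Sum>z\<in>UNIV. next_obs_prob y k z * err (y(Suc k := z)) (Suc k))
      = (\<Sum>z\<in>UNIV. push \<Phi>' ?p' z * tv_dist (bayes \<Phi> ?p z) (bayes \<Phi>' ?p' z))"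
    by (simp add: next_obs_prob_def)
  also have "\<dots> \<le> (2 - \<kappa>O) * tv_dist ?p ?p' + 2 * eO"
    by (intro expected_tv_dist_bayes_le \<Phi> \<Phi>' prob_vector_push P P' prob_vector_beliefs overlap_\<Phi> close_\<Phi>)
  also have "tv_dist ?p ?p' \<le> tv_dist ?p (push (\<lambda>s. P s (act k)) ?b') + tv_dist (push (\<lambda>s. P s (act k)) ?b') ?p'"
    by (rule tv_dist_triangle)
  also have "\<dots> \<le> (1 - \<kappa>P) * err y k + eP"
    unfolding err_def
    by (intro add_mono tv_dist_push_le_contraction tv_dist_push_le_kernel P prob_vector_beliefs overlap_P close_P)
  finally have "(\<Sum>z\<in>UNIV. next_obs_prob y k z * err (y(Suc k := z)) (Suc k))
      \<le> (2 - \<kappa>O) * ((1 - \<kappa>P) * err y k + eP) + 2 * eO"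
    using kappa_le_1 by simp
  also have "\<dots> = (2 - \<kappa>O) * ((1 - \<kappa>P) * err y k) + ((2 - \<kappa>O) * eP + 2 * eO)"
    by (simp add: algebra_simps)
  \<comment> \<open>both \<open>2 - \<kappa> \<le> 4 - 3 * \<kappa>\<close> and \<open>2 - \<kappa> \<le> 3 - 2 * \<kappa>\<close> amount to \<open>\<kappa> \<le> 1\<close>\<close>
  also have "\<dots> \<le> (4 - 3 * \<kappa>O) * ((1 - \<kappa>P) * err y k) + ((3 - 2 * \<kappa>O) * eP + 2 * eO)"
    using kappa_le_1 close_nonneg err_nonneg[of y k] by (intro add_mono mult_right_mono) auto
  finally show ?thesis by (simp add: rate_def drift_def algebra_simps)
qed

text \<open>
  The states before time \<open>j\<close> are summed out one at a time, from the front.  Each summation is one step of the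
  unnormalized filter: prediction, then multiplication by the likelihood; its normalizing constant
  is exactly the next factor of \<open>obs_prob\<close>.
\<close>

lemma measure_path_tail:
  assumes gen: "generated_under \<nu>0 P' \<Phi>' act M S Y" and "j \<le> n"
  shows "measure M {x \<in> space M. (\<forall>k\<in>{j..n}. S k x = s k) \<and> (\<forall>k\<in>{1..n}. Y k x = y k)}
    = obs_prob y j * belief \<nu>0 P' \<Phi>' act y j (s j)
      * (\<Prod>k=j..<n. P' (s k) (act k) (s (Suc k)) * \<Phi>' (s (Suc k)) (y (Suc k)))"
  using \<open>j \<le> n\<close>
proof (induction j arbitrary: s)
  case 0
  have "{x \<in> space M. (\<forall>k\<in>{0..n}. S k x = s k) \<and> (\<forall>k\<in>{1..n}. Y k x = y k)}
      = {x \<in> space M. (\<forall>k\<le>n. S k x = s k) \<and> (\<forall>k\<in>{1..n}. Y k x = y k)}" by auto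
  then show ?case
    using gen by (simp add: generated_under_def obs_prob_def atLeast0LessThan)
next
  case (Suc j)
  interpret prob_space M using gen by (simp add: generated_under_def)
  let ?E = "\<lambda>\<sigma>. {x \<in> space M. (\<forall>k\<in>{j..n}. S k x = (s(j := \<sigma>)) k) \<and> (\<forall>k\<in>{1..n}. Y k x = y k)}"
  let ?R = "\<Prod>k=Suc j..<n. P' (s k) (act k) (s (Suc k)) * \<Phi>' (s (Suc k)) (y (Suc k))"
  let ?b = "belief \<nu>0 P' \<Phi>' act y j"
  have [measurable]: "S k \<in> measurable M (count_space UNIV)" for k
    using gen by (simp add: generated_under_def)
  have meas: "?E \<sigma> \<in> sets M" for \<sigma>
  proof -
    have "{x \<in> space M. \<forall>k\<in>{j..n}. S k x = (s(j := \<sigma>)) k} \<in> sets M" by measurable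
    then show ?thesis by (intro sets.sets_Collect_conj sets_obs_prefix[OF gen])
  qed
  have "{x \<in> space M. (\<forall>k\<in>{Suc j..n}. S k x = s k) \<and> (\<forall>k\<in>{1..n}. Y k x = y k)} = (\<Union>\<sigma>\<in>UNIV. ?E \<sigma>)"
  proof -
    have "(\<forall>k\<in>{j..n}. S k x = (s(j := S j x)) k)" if "\<forall>k\<in>{Suc j..n}. S k x = s k" for x
      using that by (auto simp: le_less Suc_le_eq)
    moreover have "S k x = s k" if "\<forall>k\<in>{j..n}. S k x = (s(j := \<sigma>)) k" "k \<in> {Suc j..n}" for x k \<sigma>
      using that by auto
    ultimately show ?thesis by blast
  qed
  moreover have "disjoint_family ?E"
  proof -
    have "j \<in> {j..n}" using Suc.prems by simp
    then have "S j x = \<sigma>" if "x \<in> ?E \<sigma>" for x \<sigma> using that by fastforce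
    then show ?thesis unfolding disjoint_family_on_def by blast
  qed
  ultimately have "measure M {x \<in> space M. (\<forall>k\<in>{Suc j..n}. S k x = s k) \<and> (\<forall>k\<in>{1..n}. Y k x = y k)}
      = (\<Sum>\<sigma>\<in>UNIV. measure M (?E \<sigma>))"
    using meas by (simp add: finite_measure_finite_Union image_subset_iff)
  also have "\<dots> = (\<Sum>\<sigma>\<in>UNIV. obs_prob y j * ?b \<sigma> * (P' \<sigma> (act j) (s (Suc j)) * \<Phi>' (s (Suc j)) (y (Suc j)) * ?R))"
  proof (rule sum.cong[OF refl])
    fix \<sigma>
    have "(\<Prod>k=j..<n. P' ((s(j := \<sigma>)) k) (act k) ((s(j := \<sigma>)) (Suc k)) * \<Phi>' ((s(j := \<sigma>)) (Suc k)) (y (Suc k)))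
      = P' \<sigma> (act j) (s (Suc j)) * \<Phi>' (s (Suc j)) (y (Suc j)) * ?R"
      using Suc.prems by (simp add: prod.atLeast_Suc_lessThan)
    then show "measure M (?E \<sigma>) = obs_prob y j * ?b \<sigma> * (P' \<sigma> (act j) (s (Suc j)) * \<Phi>' (s (Suc j)) (y (Suc j)) * ?R)"
      using Suc.IH[of "s(j := \<sigma>)"] Suc.prems by simp
  qed
  also have "\<dots> = obs_prob y j * (\<Phi>' (s (Suc j)) (y (Suc j)) * push (\<lambda>s. P' s (act j)) ?b (s (Suc j))) * ?R"
    by (simp add: push_def sum_distrib_left sum_distrib_right mult_ac)
  also have "\<dots> = obs_prob y (Suc j) * belief \<nu>0 P' \<Phi>' act y (Suc j) (s (Suc j)) * ?R"
    using next_obs_prob_pos[of y j "y (Suc j)"]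
    by (simp add: obs_prob_def belief_Suc_eq_bayes bayes_def next_obs_prob_def del: belief.simps(2))
  finally show ?case .
qed

end

section \<open>Concentration of the average error\<close>

lemma exp_mult_le_chord:
  fixes x l :: real
  assumes "0 \<le> x" "x \<le> 1"
  shows "exp (l * x) \<le> 1 + (exp l - 1) * x"
proof -
  have "exp ((1 - x) *\<^sub>R 0 + x *\<^sub>R l) \<le> (1 - x) * exp 0 + x * exp l"
    using assms by (intro convex_onD[OF exp_convex]) auto
  then show ?thesis by (simp add: algebra_simps)
qed

text \<open>
  Bernstein's estimate \<open>exp l - 1 \<le> l + l\<^sup>2 / (2 (1 - l/3))\<close> for \<open>0 < l < 3\<close>, parametrized by the relative excess
  \<open>\<psi> = l / (2 (1 - l/3))\<close>, because \<open>1 / l\<close> is then affine in \<open>1 / \<psi>\<close>.  After clearing denominators the estimate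
  reads \<open>exp l * (6 - 2 l) \<le> 6 + 4 l + l\<^sup>2\<close>, a Pade bound for the exponential.
\<close>

lemma exp_minus_one_le_bernstein:
  fixes \<psi> :: real
  assumes "0 < \<psi>"
  defines "l \<equiv> 1 / (1 / (2 * \<psi>) + 1 / 3)"
  shows "exp l - 1 \<le> l * (1 + \<psi>)"
proof -
  have "0 < 1 / (2 * \<psi>) + 1 / 3" using assms by (intro add_pos_pos) auto
  then have l: "0 < l" and "1 / l = 1 / (2 * \<psi>) + 1 / 3" by (auto simp: l_def)
  then have \<psi>: "\<psi> * (6 - 2 * l) = 3 * l" using assms(1) by (simp add: field_simps)
  then have l3: "0 < 6 - 2 * l"
    using l assms(1) by (metis zero_less_mult_pos mult_pos_pos zero_less_numeral)
  let ?g = "\<lambda>x::real. exp (- x) * (6 + 4 * x + x^2) - (6 - 2 * x)"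
  have "?g 0 \<le> ?g l"
  proof (rule DERIV_nonneg_imp_nondecreasing[of 0 l ?g])
    show "0 \<le> l" using l by simp
    fix x :: real assume x: "0 \<le> x"
    have deriv: "(?g has_real_derivative (2 - exp (- x) * (2 + 2 * x + x^2))) (at x)"
      by (auto intro!: derivative_eq_intros simp: power2_eq_square algebra_simps)
    have "exp (- x) * (2 + 2 * x + x^2) \<le> exp (- x) * (2 * exp x)"
      using exp_lower_Taylor_quadratic[OF x] by (intro mult_left_mono) auto
    moreover have "exp (- x) * (2 * exp x) = 2" by (simp add: exp_minus)
    ultimately have "0 \<le> 2 - exp (- x) * (2 + 2 * x + x^2)" by linarith
    then show "\<exists>D. (?g has_real_derivative D) (at x) \<and> 0 \<le> D" using deriv by blast
  qed
  then have "exp l * (6 - 2 * l) \<le> exp l * (exp (- l) * (6 + 4 * l + l^2))"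
    by (intro mult_left_mono) auto
  also have "\<dots> = 6 + 4 * l + l^2" by (simp add: exp_minus)
  also have "\<dots> = (1 + l * (1 + \<psi>)) * (6 - 2 * l)"
  proof -
    have "(1 + l * (1 + \<psi>)) * (6 - 2 * l) = (1 + l) * (6 - 2 * l) + l * (\<psi> * (6 - 2 * l))"
      by (simp add: algebra_simps)
    then show ?thesis unfolding \<psi> by (simp add: power2_eq_square algebra_simps)
  qed
  finally show ?thesis using l3 by simp
qed

text \<open>
  The choice of \<open>\<psi>\<close>.  The term \<open>\<psi> c n + L / (2 \<psi>)\<close> is minimal at \<open>\<psi> = L / r\<close> with \<open>r = sqrt (2 c L n)\<close>, where it equals
  \<open>r\<close>.  If this violates \<open>\<psi> \<alpha> \<le> (1 - \<alpha>)/2\<close> (or is undefined because \<open>c = 0\<close>), the boundary value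
  \<open>\<psi> = (1 - \<alpha>) / (2 \<alpha>)\<close> is taken, and \<open>L / (2 \<psi>) = L \<alpha> / (1 - \<alpha>)\<close> is the origin of the last term of the bound.
  For \<open>\<alpha> = c = 0\<close> the value \<open>\<psi> = 3/2\<close> gives \<open>L / (2 \<psi>) = L/3\<close>; together with the \<open>L/3\<close> of Bernstein's estimate this
  accounts for the constant \<open>4/3\<close>.
  The parameter does not depend on the sum, because it enters the supermartingale.
\<close>

lemma exists_bernstein_parameter:
  fixes \<alpha> c \<delta> :: real
  assumes \<alpha>: "0 \<le> \<alpha>" "\<alpha> < 1" and c: "0 \<le> c" and \<delta>: "0 < \<delta>" "\<delta> < 1" and n: "1 \<le> n"
  obtains \<psi> where "0 < \<psi>"
    "\<And>\<Sigma>. 0 \<le> \<Sigma> \<Longrightarrow> \<Sigma> \<le> (1 + \<psi>) * (\<alpha> * \<Sigma> + c * real n) + ln (1 / \<delta>) * (1 / (2 * \<psi>) + 1 / 3)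
       \<Longrightarrow> (1 / real n) * \<Sigma> \<le> avg_belief_bound c \<alpha> \<delta> n"
proof -
  define L where "L = ln (1 / \<delta>)"
  define r where "r = sqrt (2 * c * L * real n)"
  have L: "0 < L" unfolding L_def using \<delta> by simp
  have r: "0 \<le> r" "r^2 = 2 * c * L * real n" using c L by (simp_all add: r_def)
  have "\<exists>\<psi>>0. \<psi> * \<alpha> \<le> (1 - \<alpha>) / 2 \<and> \<psi> * (c * real n) + L / (2 * \<psi>) \<le> r + L * \<alpha> / (1 - \<alpha>) + L / 3"
  proof -
    have nonneg: "0 \<le> L * \<alpha> / (1 - \<alpha>)" using L \<alpha> by simp
    consider "0 < c" "L / r * \<alpha> \<le> (1 - \<alpha>) / 2"
      | "0 < \<alpha>" "0 < c \<Longrightarrow> (1 - \<alpha>) / 2 < L / r * \<alpha>"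
      | "\<alpha> = 0" "c = 0"
      using \<alpha> c by fastforce
    then show ?thesis
    proof cases
      case 1
      then have rpos: "0 < r" using L n by (simp add: r_def)
      have "L / r * (c * real n) = r / 2" "L / (2 * (L / r)) = r / 2"
        using rpos r(2) L by (simp_all add: field_simps power2_eq_square)
      then show ?thesis using 1 rpos L nonneg by (intro exI[of _ "L / r"]) auto
    next
      case 2
      let ?\<psi> = "(1 - \<alpha>) / (2 * \<alpha>)"
      have "?\<psi> * (c * real n) \<le> r"
      proof (cases "c = 0")
        case False
        then have rpos: "0 < r" and cpos: "0 < c" using c L n by (simp_all add: r_def)
        have "?\<psi> \<le> L / r" using 2 cpos by (simp add: field_simps)
        then have "?\<psi> * (c * real n) \<le> L / r * (c * real n)" using cpos by (intro mult_right_mono) auto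
        also have "\<dots> = r / 2" using rpos r(2) by (simp add: field_simps power2_eq_square)
        finally show ?thesis using rpos by simp
      qed (use r in simp)
      moreover have "L / (2 * ?\<psi>) = L * \<alpha> / (1 - \<alpha>)" "?\<psi> * \<alpha> = (1 - \<alpha>) / 2" "0 < ?\<psi>"
        using 2 \<alpha> by (simp_all add: field_simps)
      ultimately show ?thesis using L by (intro exI[of _ ?\<psi>]) auto
    next
      case 3
      then show ?thesis using r L by (intro exI[of _ "3/2"]) auto
    qed
  qed
  then obtain \<psi> where \<psi>: "0 < \<psi>" "\<psi> * \<alpha> \<le> (1 - \<alpha>) / 2"
    "\<psi> * (c * real n) + L / (2 * \<psi>) \<le> r + L * \<alpha> / (1 - \<alpha>) + L / 3" by blast
  show thesis
  proof (rule that[OF \<psi>(1)])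
    fix \<Sigma> :: real
    assume \<Sigma>: "0 \<le> \<Sigma>" "\<Sigma> \<le> (1 + \<psi>) * (\<alpha> * \<Sigma> + c * real n) + ln (1 / \<delta>) * (1 / (2 * \<psi>) + 1 / 3)"
    have "\<Sigma> \<le> \<alpha> * \<Sigma> + (\<psi> * \<alpha>) * \<Sigma> + c * real n + (\<psi> * (c * real n) + L / (2 * \<psi>)) + L / 3"
      using \<Sigma>(2) by (simp add: L_def algebra_simps)
    also have "\<dots> \<le> \<alpha> * \<Sigma> + ((1 - \<alpha>) / 2) * \<Sigma> + c * real n + (r + L * \<alpha> / (1 - \<alpha>) + L / 3) + L / 3"
      using mult_right_mono[OF \<psi>(2) \<Sigma>(1)] \<psi>(3) by linarith
    finally have "\<Sigma> * ((1 - \<alpha>) / 2) \<le> c * real n + r + L * \<alpha> / (1 - \<alpha>) + 2 * L / 3"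
      by (simp add: field_simps)
    then have "\<Sigma> \<le> (c * real n + r + L * \<alpha> / (1 - \<alpha>) + 2 * L / 3) / ((1 - \<alpha>) / 2)"
      using \<alpha> by (simp add: pos_le_divide_eq)
    then have "(1 / real n) * \<Sigma> \<le> (1 / real n) * ((c * real n + r + L * \<alpha> / (1 - \<alpha>) + 2 * L / 3) / ((1 - \<alpha>) / 2))"
      by (intro mult_left_mono) auto
    also have "\<dots> = 2 * c / (1 - \<alpha>) + 2 / (1 - \<alpha>) * (r / real n) + L / (real n * (1 - \<alpha>)) * (4/3 + 2 * \<alpha> / (1 - \<alpha>))"
    proof -
      have "1 - \<alpha> \<noteq> 0" "real n \<noteq> 0" using \<alpha> n by auto
      then show ?thesis by (simp add: divide_simps) (simp add: algebra_simps)
    qed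
    also have "r / real n = sqrt (2 * c * L / real n)"
    proof -
      have "2 * c * L / real n = 2 * c * L * real n / (real n)^2" using n by (simp add: power2_eq_square)
      then show ?thesis by (simp add: r_def real_sqrt_divide)
    qed
    finally show "(1 / real n) * \<Sigma> \<le> avg_belief_bound c \<alpha> \<delta> n"
      by (simp add: avg_belief_bound_def L_def)
  qed
qed

context two_filters
begin

text \<open>
  The factor \<open>exp l - 1\<close>, instead of \<open>l\<close>, in the compensator is the price for replacing the error by an exponential.
\<close>

definition err_supermartingale :: "real \<Rightarrow> (nat \<Rightarrow> 'o) \<Rightarrow> nat \<Rightarrow> real" where
  "err_supermartingale l y n = (\<Prod>k<n. exp (l * err y (Suc k) - (exp l - 1) * (rate * err y k + drift)))"

lemma err_supermartingale_cong:
  "(\<And>k. 1 \<le> k \<Longrightarrow> k \<le> n \<Longrightarrow> y k = y' k) \<Longrightarrow> err_supermartingale l y n = err_supermartingale l y' n"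
  unfolding err_supermartingale_def by (intro prod.cong refl) (simp add: err_cong[of _ y y'])

lemma err_supermartingale_nonneg: "0 \<le> err_supermartingale l y n"
  unfolding err_supermartingale_def by (intro prod_nonneg) simp

text \<open>
  The chord bound turns the exponential moment of the next error into its mean, which the drift inequality controls;
  \<open>1 + x \<le> exp x\<close> then brings the result into the form of the compensating factor.
\<close>

lemma err_supermartingale_step:
  assumes "0 \<le> l"
  shows "(\<Sum>z\<in>UNIV. next_obs_prob y n z * err_supermartingale l (y(Suc n := z)) (Suc n)) \<le> err_supermartingale l y n"
proof -
  let ?d = "rate * err y n + drift"
  have agree: "err_supermartingale l (y(Suc n := z)) n = err_supermartingale l y n" "err (y(Suc n := z)) n = err y n" for z
    by (auto intro!: err_supermartingale_cong err_cong)
  have "(\<Sum>z\<in>UNIV. next_obs_prob y n z * exp (l * err (y(Suc n := z)) (Suc n)))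
      \<le> (\<Sum>z\<in>UNIV. next_obs_prob y n z * (1 + (exp l - 1) * err (y(Suc n := z)) (Suc n)))"
    by (intro sum_mono mult_left_mono exp_mult_le_chord err_nonneg err_le_1)
       (simp add: next_obs_prob_pos less_imp_le)
  also have "\<dots> = 1 + (exp l - 1) * (\<Sum>z\<in>UNIV. next_obs_prob y n z * err (y(Suc n := z)) (Suc n))"
    using prob_vector_next_obs[of y n]
    by (simp add: prob_vector_def algebra_simps sum.distrib sum_subtractf sum_distrib_left)
  also have "\<dots> \<le> 1 + (exp l - 1) * ?d"
    using assms by (intro add_left_mono mult_left_mono expected_err_step) auto
  also have "\<dots> \<le> exp ((exp l - 1) * ?d)" by (rule exp_ge_add_one_self)
  finally have step: "(\<Sum>z\<in>UNIV. next_obs_prob y n z * exp (l * err (y(Suc n := z)) (Suc n))) \<le> exp ((exp l - 1) * ?d)" .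
  have last: "err_supermartingale l (y(Suc n := z)) (Suc n)
      = err_supermartingale l y n * exp (- (exp l - 1) * ?d) * exp (l * err (y(Suc n := z)) (Suc n))" for z
  proof -
    have "err_supermartingale l (y(Suc n := z)) (Suc n) = err_supermartingale l (y(Suc n := z)) n
        * exp (l * err (y(Suc n := z)) (Suc n) - (exp l - 1) * (rate * err (y(Suc n := z)) n + drift))"
      by (simp only: err_supermartingale_def prod.lessThan_Suc)
    also have "\<dots> = err_supermartingale l y n * exp (l * err (y(Suc n := z)) (Suc n) + - (exp l - 1) * ?d)"
      unfolding agree by (simp only: mult_minus_left diff_conv_add_uminus)
    finally show ?thesis by (simp only: exp_add mult_ac)
  qed
  have "(\<Sum>z\<in>UNIV. next_obs_prob y n z * err_supermartingale l (y(Suc n := z)) (Suc n))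
      = err_supermartingale l y n * exp (- (exp l - 1) * ?d)
        * (\<Sum>z\<in>UNIV. next_obs_prob y n z * exp (l * err (y(Suc n := z)) (Suc n)))"
    unfolding last by (simp only: sum_distrib_left mult_ac)
  also have "\<dots> \<le> err_supermartingale l y n * exp (- (exp l - 1) * ?d) * exp ((exp l - 1) * ?d)"
    using step by (intro mult_left_mono) (auto simp: err_supermartingale_nonneg)
  also have "\<dots> = err_supermartingale l y n" 
  proof -
    have "exp (- t) * exp t = 1" for t :: real by (simp add: exp_minus)
    from this[of "(exp l - 1) * ?d"] show ?thesis
      by (simp only: mult.assoc mult_minus_left mult_1_right)
  qed
  finally show ?thesis .
qed

lemma borel_measurable_err:
  assumes "generated_under \<nu>0 P' \<Phi>' act M S Y"
  shows "(\<lambda>x. err (\<lambda>k. Y k x) t) \<in> borel_measurable M"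
  unfolding err_def using assms
  by (intro borel_measurable_tv_dist borel_measurable_belief) (auto simp: generated_under_def)

lemma borel_measurable_err_supermartingale:
  assumes "generated_under \<nu>0 P' \<Phi>' act M S Y"
  shows "(\<lambda>x. err_supermartingale l (\<lambda>k. Y k x) n) \<in> borel_measurable M"
proof -
  note [measurable] = borel_measurable_err[OF assms]
  show ?thesis unfolding err_supermartingale_def by measurable
qed

lemma measure_obs_prefix:
  assumes gen: "generated_under \<nu>0 P' \<Phi>' act M S Y"
  shows "measure M {x \<in> space M. \<forall>k\<in>{1..n}. Y k x = y k} = obs_prob y n"
proof -
  interpret prob_space M using gen by (simp add: generated_under_def)
  let ?E = "\<lambda>\<sigma>. {x \<in> space M. (\<forall>k\<in>{n..n}. S k x = \<sigma>) \<and> (\<forall>k\<in>{1..n}. Y k x = y k)}"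
  have [measurable]: "S n \<in> measurable M (count_space UNIV)"
    using gen by (simp add: generated_under_def)
  have "{x \<in> space M. (\<forall>k\<in>{n..n}. S k x = \<sigma>)} \<in> sets M" for \<sigma> by simp measurable
  then have meas: "?E \<sigma> \<in> sets M" for \<sigma>
    by (intro sets.sets_Collect_conj sets_obs_prefix[OF gen])
  have "{x \<in> space M. \<forall>k\<in>{1..n}. Y k x = y k} = (\<Union>\<sigma>\<in>UNIV. ?E \<sigma>)" by auto
  moreover have "disjoint_family ?E" by (auto simp: disjoint_family_on_def)
  ultimately have "measure M {x \<in> space M. \<forall>k\<in>{1..n}. Y k x = y k} = (\<Sum>\<sigma>\<in>UNIV. measure M (?E \<sigma>))"
    using meas by (simp add: finite_measure_finite_Union image_subset_iff)
  also have "\<dots> = (\<Sum>\<sigma>\<in>UNIV. obs_prob y n * belief \<nu>0 P' \<Phi>' act y n \<sigma>)"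
  proof (rule sum.cong[OF refl])
    fix \<sigma>
    show "measure M (?E \<sigma>) = obs_prob y n * belief \<nu>0 P' \<Phi>' act y n \<sigma>"
      using measure_path_tail[OF gen order_refl[of n], of "\<lambda>_. \<sigma>" y] by (simp only: atLeastLessThan_empty[OF order_refl] prod.empty mult_1_right)
  qed
  also have "\<dots> = obs_prob y n"
    using prob_vector_beliefs(2)[of y n] by (simp add: prob_vector_def flip: sum_distrib_left)
  finally show ?thesis .
qed

text \<open>
  Markov's inequality for the supermartingale, restricted to the event that the first \<open>j\<close> observations are given by \<open>y\<close>.
  With the prefix as a parameter, the iterated expectation becomes an induction that goes back from
  \<open>j = n\<close>, where the supermartingale is constant on the event, to \<open>j = 0\<close>, where it is 1.
\<close>

lemma measure_err_supermartingale_large: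
  assumes gen: "generated_under \<nu>0 P' \<Phi>' act M S Y" and l: "0 \<le> l" and \<delta>: "0 < \<delta>" and "j \<le> n"
  shows "measure M {x \<in> space M. (\<forall>k\<in>{1..j}. Y k x = y k) \<and> 1 / \<delta> \<le> err_supermartingale l (\<lambda>k. Y k x) n}
      \<le> \<delta> * (obs_prob y j * err_supermartingale l y j)"
  using \<open>j \<le> n\<close>
proof (induction "n - j" arbitrary: j y)
  case 0
  then have j: "j = n" by simp
  interpret prob_space M using gen by (simp add: generated_under_def)
  have eq: "err_supermartingale l (\<lambda>k. Y k x) n = err_supermartingale l y n" if "\<forall>k\<in>{1..n}. Y k x = y k" for x
    using that by (intro err_supermartingale_cong) auto
  show ?case
  proof (cases "1 / \<delta> \<le> err_supermartingale l y n")
    case True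
    have "measure M {x \<in> space M. (\<forall>k\<in>{1..j}. Y k x = y k) \<and> 1 / \<delta> \<le> err_supermartingale l (\<lambda>k. Y k x) n} \<le> obs_prob y n"
      unfolding j measure_obs_prefix[OF gen, symmetric]
      by (intro finite_measure_mono sets_obs_prefix[OF gen]) auto
    also have "\<dots> \<le> obs_prob y n * (\<delta> * err_supermartingale l y n)"
    proof -
      have "1 \<le> \<delta> * err_supermartingale l y n" using True \<delta> by (simp add: field_simps)
      from mult_left_mono[OF this obs_prob_nonneg[of y n]] show ?thesis by simp
    qed
    finally show ?thesis by (simp add: j mult_ac)
  next
    case False
    have empty: "{x \<in> space M. (\<forall>k\<in>{1..j}. Y k x = y k) \<and> 1 / \<delta> \<le> err_supermartingale l (\<lambda>k. Y k x) n} = {}"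
      unfolding j using False by (simp add: eq cong: conj_cong)
    show ?thesis unfolding empty using \<delta> by (simp add: obs_prob_nonneg err_supermartingale_nonneg)
  qed
next
  case (Suc i)
  interpret prob_space M using gen by (simp add: generated_under_def)
  let ?A = "\<lambda>j y. {x \<in> space M. (\<forall>k\<in>{1..j}. Y k x = y k) \<and> 1 / \<delta> \<le> err_supermartingale l (\<lambda>k. Y k x) n}"
  note [measurable] = borel_measurable_err_supermartingale[OF gen]
  have "{x \<in> space M. 1 / \<delta> \<le> err_supermartingale l (\<lambda>k. Y k x) n} \<in> sets M" by measurable
  then have meas: "?A j y \<in> sets M" for j y
    by (intro sets.sets_Collect_conj sets_obs_prefix[OF gen])
  have split: "?A (Suc j) (y(Suc j := z)) = {x \<in> ?A j y. Y (Suc j) x = z}" for z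
  proof -
    have "(\<forall>k\<in>{1..Suc j}. Y k x = (y(Suc j := z)) k) \<longleftrightarrow> (\<forall>k\<in>{1..j}. Y k x = y k) \<and> Y (Suc j) x = z" for x
      using atLeastAtMostSuc_conv[of 1 j] by auto
    then show ?thesis by (simp only:) blast
  qed
  have "?A j y = (\<Union>z\<in>UNIV. ?A (Suc j) (y(Suc j := z)))" unfolding split by blast
  moreover have "disjoint_family (\<lambda>z. ?A (Suc j) (y(Suc j := z)))"
    unfolding split disjoint_family_on_def by blast
  ultimately have "measure M (?A j y) = (\<Sum>z\<in>UNIV. measure M (?A (Suc j) (y(Suc j := z))))"
    using meas by (simp add: finite_measure_finite_Union image_subset_iff)
  also have "\<dots> \<le> (\<Sum>z\<in>UNIV. \<delta> * (obs_prob (y(Suc j := z)) (Suc j) * err_supermartingale l (y(Suc j := z)) (Suc j)))"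
    using Suc.hyps by (intro sum_mono Suc.hyps(1)) auto
  also have "\<dots> = \<delta> * (obs_prob y j * (\<Sum>z\<in>UNIV. next_obs_prob y j z * err_supermartingale l (y(Suc j := z)) (Suc j)))"
    by (simp add: obs_prob_extend sum_distrib_left mult_ac)
  also have "\<dots> \<le> \<delta> * (obs_prob y j * err_supermartingale l y j)"
    using \<delta> by (intro mult_left_mono err_supermartingale_step l) (auto simp: obs_prob_nonneg)
  finally show ?case .
qed

text \<open>
  The first \<open>n - 1\<close> steps of the supermartingale suffice: as \<open>X\<^sub>0 = 0\<close>, the shifted sum of the \<open>X\<^sub>k\<^sub>+\<^sub>1\<close> equals the
  sum of all \<open>n\<close> errors.
\<close>

theorem average_error_concentration:
  assumes gen: "generated_under \<nu>0 P' \<Phi>' act M S Y"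
    and rate: "rate < 1" and \<delta>: "0 < \<delta>" "\<delta> < 1" and n: "1 \<le> n"
  shows "1 - \<delta> \<le> measure M {x \<in> space M.
    (1 / real n) * (\<Sum>t<n. err (\<lambda>k. Y k x) t) \<le> avg_belief_bound drift rate \<delta> n}"
proof -
  interpret prob_space M using gen by (simp add: generated_under_def)
  obtain \<psi> where \<psi>: "0 < \<psi>" and bound: "\<And>\<Sigma>. 0 \<le> \<Sigma> \<Longrightarrow>
      \<Sigma> \<le> (1 + \<psi>) * (rate * \<Sigma> + drift * real n) + ln (1 / \<delta>) * (1 / (2 * \<psi>) + 1 / 3)
      \<Longrightarrow> (1 / real n) * \<Sigma> \<le> avg_belief_bound drift rate \<delta> n"
    using exists_bernstein_parameter[OF rate_nonneg rate drift_nonneg \<delta> n] by blast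
  define l where "l = 1 / (1 / (2 * \<psi>) + 1 / 3)"
  have "0 < 1 / (2 * \<psi>) + 1 / 3" using \<psi> by (intro add_pos_pos) auto
  then have l: "0 < l" and inv_l: "1 / l = 1 / (2 * \<psi>) + 1 / 3" by (auto simp: l_def)
  have exp_l: "exp l - 1 \<le> l * (1 + \<psi>)"
    unfolding l_def by (rule exp_minus_one_le_bernstein[OF \<psi>])
  obtain m where m: "n = Suc m" using n by (cases n) auto
  let ?good = "{x \<in> space M. (1 / real n) * (\<Sum>t<n. err (\<lambda>k. Y k x) t) \<le> avg_belief_bound drift rate \<delta> n}"
  let ?bad = "{x \<in> space M. 1 / \<delta> \<le> err_supermartingale l (\<lambda>k. Y k x) m}"
  note [measurable] = borel_measurable_err[OF gen] borel_measurable_err_supermartingale[OF gen]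
  have good_sets: "?good \<in> sets M" by measurable
  have bad_sets: "?bad \<in> sets M" by measurable
  have "measure M ?bad \<le> \<delta>"
    using measure_err_supermartingale_large[OF gen less_imp_le[OF l] \<delta>(1), of 0 m]
    by (simp add: obs_prob_def err_supermartingale_def)
  moreover have "space M - ?bad \<subseteq> ?good"
  proof safe
    fix x assume x: "x \<in> space M" and nbad: "\<not> 1 / \<delta> \<le> err_supermartingale l (\<lambda>k. Y k x) m"
    let ?e = "err (\<lambda>k. Y k x)"
    let ?\<Sigma> = "\<Sum>t<n. ?e t"
    have shift: "(\<Sum>k<m. ?e (Suc k)) = ?\<Sigma>"
      unfolding m sum.lessThan_Suc_shift by (simp add: err_0)
    have "err_supermartingale l (\<lambda>k. Y k x) m = exp (\<Sum>k<m. l * ?e (Suc k) - (exp l - 1) * (rate * ?e k + drift))"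
      by (simp add: err_supermartingale_def exp_sum)
    also have "(\<Sum>k<m. l * ?e (Suc k) - (exp l - 1) * (rate * ?e k + drift))
        = l * ?\<Sigma> - (exp l - 1) * (\<Sum>k<m. rate * ?e k + drift)"
      unfolding sum_subtractf sum_distrib_left[symmetric] shift by simp
    finally have "exp (l * ?\<Sigma> - (exp l - 1) * (\<Sum>k<m. rate * ?e k + drift)) < exp (ln (1 / \<delta>))"
      using nbad \<delta> by simp
    then have "l * ?\<Sigma> < (exp l - 1) * (\<Sum>k<m. rate * ?e k + drift) + ln (1 / \<delta>)" by simp
    also have "(exp l - 1) * (\<Sum>k<m. rate * ?e k + drift) \<le> (l * (1 + \<psi>)) * (\<Sum>k<n. rate * ?e k + drift)"
      using exp_l l rate_nonneg drift_nonneg \<psi>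
      by (intro mult_mono sum_mono2) (auto simp: m intro!: sum_nonneg add_nonneg_nonneg mult_nonneg_nonneg err_nonneg)
    also have "(\<Sum>k<n. rate * ?e k + drift) = rate * ?\<Sigma> + drift * real n"
      by (simp add: sum.distrib sum_distrib_left)
    finally have "l * ?\<Sigma> \<le> l * ((1 + \<psi>) * (rate * ?\<Sigma> + drift * real n) + ln (1 / \<delta>) * (1 / l))"
      using l by (simp add: algebra_simps)
    then have "?\<Sigma> \<le> (1 + \<psi>) * (rate * ?\<Sigma> + drift * real n) + ln (1 / \<delta>) * (1 / (2 * \<psi>) + 1 / 3)"
      unfolding inv_l using l by simp
    then show "(1 / real n) * ?\<Sigma> \<le> avg_belief_bound drift rate \<delta> n"
      by (intro bound sum_nonneg err_nonneg) 
  qed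
  then have "measure M (space M - ?bad) \<le> measure M ?good"
    using good_sets by (rule finite_measure_mono)
  ultimately show ?thesis using prob_compl[OF bad_sets] by simp
qed

end

section \<open>Log-linear and neural-softmax models\<close>

lemma finite_INF_le:
  fixes g :: "'i::finite \<Rightarrow> real"
  shows "(INF i\<in>UNIV. g i) \<le> g i"
  by (rule cINF_lower) auto

lemma dobrushin_trans_le_overlap:
  assumes "P \<in> \<P>" and "\<And>P s a. P \<in> \<P> \<Longrightarrow> prob_vector (P s a)"
  shows "dobrushin_trans \<P> \<le> (\<Sum>x\<in>UNIV. min (P s a x) (P s' a x))"
proof -
  let ?o = "\<lambda>P. \<lambda>(s, s', a). \<Sum>x\<in>UNIV. min (P s a x) (P s' a x) :: real"
  have "0 \<le> (INF i\<in>UNIV. ?o P i)" if "P \<in> \<P>" for P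
    using assms(2)[OF that] by (intro cINF_greatest) (auto simp: prob_vector_def intro!: sum_nonneg)
  then have "bdd_below ((\<lambda>P. INF i\<in>UNIV. ?o P i) ` \<P>)" by (intro bdd_belowI2[of _ 0]) auto
  then have "dobrushin_trans \<P> \<le> (INF i\<in>UNIV. ?o P i)"
    unfolding dobrushin_trans_def using assms(1) by (rule cINF_lower)
  also have "\<dots> \<le> ?o P (s, s', a)" by (rule finite_INF_le)
  finally show ?thesis by simp
qed

lemma dobrushin_obs_le_overlap:
  assumes "\<Phi> \<in> \<Q>" and "\<And>\<Phi> s. \<Phi> \<in> \<Q> \<Longrightarrow> prob_vector (\<Phi> s)"
  shows "dobrushin_obs \<Q> \<le> (\<Sum>y\<in>UNIV. min (\<Phi> s y) (\<Phi> s' y))"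
proof -
  let ?o = "\<lambda>\<Phi>. \<lambda>(s, s'). \<Sum>y\<in>UNIV. min (\<Phi> s y) (\<Phi> s' y) :: real"
  have "0 \<le> (INF i\<in>UNIV. ?o \<Phi> i)" if "\<Phi> \<in> \<Q>" for \<Phi>
    using assms(2)[OF that] by (intro cINF_greatest) (auto simp: prob_vector_def intro!: sum_nonneg)
  then have "bdd_below ((\<lambda>\<Phi>. INF i\<in>UNIV. ?o \<Phi> i) ` \<Q>)" by (intro bdd_belowI2[of _ 0]) auto
  then have "dobrushin_obs \<Q> \<le> (INF i\<in>UNIV. ?o \<Phi> i)"
    unfolding dobrushin_obs_def using assms(1) by (rule cINF_lower)
  also have "\<dots> \<le> ?o \<Phi> (s, s')" by (rule finite_INF_le)
  finally show ?thesis by simp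
qed

lemma tv_dist_softmax_linear_le:
  assumes "\<And>x. norm (\<phi> x) \<le> B" "norm (\<theta> - \<theta>') \<le> d"
  shows "tv_dist (softmax (\<lambda>x. \<theta> \<bullet> \<phi> x)) (softmax (\<lambda>x. \<theta>' \<bullet> \<phi> x)) \<le> B * d / 2"
proof (rule tv_dist_softmax_le)
  fix x
  have "\<bar>\<theta> \<bullet> \<phi> x - \<theta>' \<bullet> \<phi> x\<bar> \<le> norm (\<theta> - \<theta>') * norm (\<phi> x)"
    unfolding inner_diff_left[symmetric] by (rule Cauchy_Schwarz_ineq2)
  also have "\<dots> \<le> d * B" using assms(2) assms(1)[of x] by (intro mult_mono) (auto intro: order_trans[OF norm_ge_zero])
  finally show "\<bar>\<theta> \<bullet> \<phi> x - \<theta>' \<bullet> \<phi> x\<bar> \<le> B * d" by (simp add: mult.commute)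
qed

text \<open>
  The linearized scores differ by an inner product with the tangent feature; passing from each network to its
  linearization costs \<open>e\<close>.
\<close>

lemma tv_dist_softmax_nn_le:
  assumes "\<And>x. norm (nn_feature r c (enc x) W0) \<le> B"
    and "\<And>x. \<bar>nn_score c W (enc x) - nn_lin_score r c W0 W (enc x)\<bar> \<le> e"
    and "\<And>x. \<bar>nn_score c W' (enc x) - nn_lin_score r c W0 W' (enc x)\<bar> \<le> e"
  shows "tv_dist (softmax (\<lambda>x. nn_score c W (enc x))) (softmax (\<lambda>x. nn_score c W' (enc x)))
    \<le> B / 2 * norm (W - W') + e"
proof -
  have "\<bar>nn_score c W (enc x) - nn_score c W' (enc x)\<bar> \<le> B * norm (W - W') + 2 * e" for x
  proof -
    let ?\<phi> = "nn_feature r c (enc x) W0"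
    have "nn_lin_score r c W0 W (enc x) - nn_lin_score r c W0 W' (enc x) = ?\<phi> \<bullet> (W - W')"
      by (simp add: nn_lin_score_def inner_diff_right)
    moreover have "\<bar>?\<phi> \<bullet> (W - W')\<bar> \<le> norm ?\<phi> * norm (W - W')" by (rule Cauchy_Schwarz_ineq2)
    moreover have "norm ?\<phi> * norm (W - W') \<le> B * norm (W - W')"
      by (intro mult_right_mono assms) simp
    ultimately show ?thesis using assms(2,3)[of x] by linarith
  qed
  then have "tv_dist (softmax (\<lambda>x. nn_score c W (enc x))) (softmax (\<lambda>x. nn_score c W' (enc x)))
      \<le> (B * norm (W - W') + 2 * e) / 2"
    by (rule tv_dist_softmax_le)
  then show ?thesis by simp
qed

lemma loglin_softmax:
  "prob_vector (loglin_trans \<phi> \<theta> s a)" "prob_vector (loglin_obs \<psi> w s)" "0 < loglin_obs \<psi> w s y"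
  by (simp_all add: loglin_trans_def loglin_obs_def prob_vector_softmax softmax_pos)

lemma nn_softmax:
  "prob_vector (nn_trans enc c W s a)" "prob_vector (nn_obs enc' c' V s)" "0 < nn_obs enc' c' V s y"
  by (simp_all add: nn_trans_def nn_obs_def prob_vector_softmax softmax_pos)

lemma two_filters_loglin:
  assumes "prob_vector \<nu>0" "\<And>s a s'. norm (\<phi>p s a s') \<le> B" "\<And>s y. norm (\<phi>o s y) \<le> B"
    and "norm (\<Theta> - \<Theta>') \<le> r" "norm (fst \<Theta> - fst \<Theta>') \<le> \<delta>\<theta>" "norm (snd \<Theta> - snd \<Theta>') \<le> \<delta>w"
  shows "two_filters \<nu>0 (loglin_trans \<phi>p (fst \<Theta>)) (loglin_trans \<phi>p (fst \<Theta>'))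
    (loglin_obs \<phi>o (snd \<Theta>)) (loglin_obs \<phi>o (snd \<Theta>'))
    (dobrushin_trans ((\<lambda>\<Xi>. loglin_trans \<phi>p (fst \<Xi>)) ` cball \<Theta>' r))
    (dobrushin_obs ((\<lambda>\<Xi>. loglin_obs \<phi>o (snd \<Xi>)) ` cball \<Theta>' r)) (B * \<delta>\<theta> / 2) (B * \<delta>w / 2)"
proof
  have \<Theta>: "\<Theta> \<in> cball \<Theta>' r" using assms(4) by (simp add: dist_norm norm_minus_commute)
  show "dobrushin_trans ((\<lambda>\<Xi>. loglin_trans \<phi>p (fst \<Xi>)) ` cball \<Theta>' r)
      \<le> (\<Sum>x\<in>UNIV. min (loglin_trans \<phi>p (fst \<Theta>) s a x) (loglin_trans \<phi>p (fst \<Theta>) s' a x))" for s s' a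
    using \<Theta> by (intro dobrushin_trans_le_overlap) (auto simp: loglin_softmax)
  show "dobrushin_obs ((\<lambda>\<Xi>. loglin_obs \<phi>o (snd \<Xi>)) ` cball \<Theta>' r)
      \<le> (\<Sum>y\<in>UNIV. min (loglin_obs \<phi>o (snd \<Theta>) s y) (loglin_obs \<phi>o (snd \<Theta>) s' y))" for s s'
    using \<Theta> by (intro dobrushin_obs_le_overlap) (auto simp: loglin_softmax)
  show "tv_dist (loglin_trans \<phi>p (fst \<Theta>) s a) (loglin_trans \<phi>p (fst \<Theta>') s a) \<le> B * \<delta>\<theta> / 2" for s a
    unfolding loglin_trans_def by (intro tv_dist_softmax_linear_le assms)
  show "tv_dist (loglin_obs \<phi>o (snd \<Theta>) s) (loglin_obs \<phi>o (snd \<Theta>') s) \<le> B * \<delta>w / 2" for s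
    unfolding loglin_obs_def by (intro tv_dist_softmax_linear_le assms)
qed (simp_all add: assms loglin_softmax)

lemma two_filters_nn:
  assumes "prob_vector \<nu>0"
    and "\<And>s a s'. norm (nn_feature r cp (xp s a s') Wp0) \<le> B" "\<And>s y. norm (nn_feature r co (xo s y) Wo0) \<le> B"
    and "\<And>W s a s'. W \<in> Dp \<Longrightarrow> \<bar>nn_score cp W (xp s a s') - nn_lin_score r cp Wp0 W (xp s a s')\<bar> \<le> ep"
    and "\<And>W s y. W \<in> Do \<Longrightarrow> \<bar>nn_score co W (xo s y) - nn_lin_score r co Wo0 W (xo s y)\<bar> \<le> eo"
    and "Wp \<in> Dp" "Wp' \<in> Dp" "Wo \<in> Do" "Wo' \<in> Do"
  shows "two_filters \<nu>0 (nn_trans xp cp Wp) (nn_trans xp cp Wp') (nn_obs xo co Wo) (nn_obs xo co Wo')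
    (dobrushin_trans (nn_trans xp cp ` Dp)) (dobrushin_obs (nn_obs xo co ` Do))
    (B / 2 * norm (Wp - Wp') + ep) (B / 2 * norm (Wo - Wo') + eo)"
proof
  show "dobrushin_trans (nn_trans xp cp ` Dp)
      \<le> (\<Sum>x\<in>UNIV. min (nn_trans xp cp Wp s a x) (nn_trans xp cp Wp s' a x))" for s s' a
    using assms by (intro dobrushin_trans_le_overlap) (auto simp: nn_softmax)
  show "dobrushin_obs (nn_obs xo co ` Do)
      \<le> (\<Sum>y\<in>UNIV. min (nn_obs xo co Wo s y) (nn_obs xo co Wo s' y))" for s s'
    using assms by (intro dobrushin_obs_le_overlap) (auto simp: nn_softmax)
  show "tv_dist (nn_trans xp cp Wp s a) (nn_trans xp cp Wp' s a) \<le> B / 2 * norm (Wp - Wp') + ep" for s a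
    unfolding nn_trans_def
    by (rule tv_dist_softmax_nn_le[where enc = "xp s a" and r = r and ?W0.0 = Wp0]) (simp_all add: assms)
  show "tv_dist (nn_obs xo co Wo s) (nn_obs xo co Wo' s) \<le> B / 2 * norm (Wo - Wo') + eo" for s
    unfolding nn_obs_def
    by (rule tv_dist_softmax_nn_le[where enc = "xo s" and r = r and ?W0.0 = Wo0]) (simp_all add: assms)
qed (simp_all add: assms nn_softmax)

section \<open>Measurability in the random initialization\<close>

lemma prob_space_rademacher: "prob_space rademacher"
  unfolding rademacher_def by (intro prob_space_uniform_count_measure) auto

lemma prob_space_std_gaussian: "prob_space (std_gaussian :: (real ^ 'd) measure)"
proof -
  let ?N = "density lborel (\<lambda>z. ennreal (std_normal_density z))"
  interpret PiM: prob_space "Pi\<^sub>M (UNIV :: 'd set) (\<lambda>_. ?N)"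
    by (intro prob_space_PiM prob_space_normal_density) simp
  have "(\<lambda>g. \<chi> i. g i) \<in> borel_measurable (Pi\<^sub>M (UNIV :: 'd set) (\<lambda>_. ?N))"
  proof (rule borel_measurable_euclidean_space[THEN iffD2], safe)
    fix b :: "real ^ 'd" assume "b \<in> Basis"
    then obtain i where b: "b = axis i 1" by (auto simp: Basis_vec_def)
    have "(\<lambda>g. g i) \<in> borel_measurable (Pi\<^sub>M (UNIV :: 'd set) (\<lambda>_. ?N))"
      using measurable_component_singleton[of i UNIV "\<lambda>_. ?N"] by (simp cong: measurable_cong_sets)
    then show "(\<lambda>g. (\<chi> i. g i) \<bullet> b) \<in> borel_measurable (Pi\<^sub>M (UNIV :: 'd set) (\<lambda>_. ?N))"
      by (simp add: b inner_axis)
  qed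
  then show ?thesis unfolding std_gaussian_def by (rule PiM.prob_space_distr)
qed

lemma prob_space_net_init_measure: "prob_space net_init_measure"
  unfolding net_init_measure_def
  by (intro prob_space_PiM prob_space_pair prob_space_rademacher prob_space_std_gaussian)

lemma prob_space_init_measure: "prob_space init_measure"
  unfolding init_measure_def by (intro prob_space_pair prob_space_net_init_measure)

lemma init_signs_in:
  assumes "\<eta> \<in> space (net_init_measure :: ('h::finite, 'd::finite) net_init measure)"
  shows "init_signs \<eta> j \<in> {-1, 1}"
proof -
  have "fst (\<eta> i) \<in> {-1, 1}" for i
    using assms by (auto simp: net_init_measure_def space_PiM PiE_iff space_pair_measure rademacher_def
        space_uniform_count_measure mem_Times_iff)
  then show ?thesis by (cases j) (force simp: init_signs_def)+
qed

lemma borel_measurable_init_signs: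
  "(\<lambda>\<eta>. init_signs \<eta> j) \<in> borel_measurable (net_init_measure :: ('h::finite, 'd::finite) net_init measure)"
proof -
  have "(\<lambda>\<eta>. \<eta> i) \<in> measurable (net_init_measure :: ('h, 'd) net_init measure) (rademacher \<Otimes>\<^sub>M std_gaussian)" for i
    unfolding net_init_measure_def by (rule measurable_component_singleton) simp
  then have "(\<lambda>\<eta>. fst (\<eta> i)) \<in> measurable (net_init_measure :: ('h, 'd) net_init measure) rademacher" for i
    by (rule measurable_compose) (rule measurable_fst)
  moreover have "(\<lambda>z. z) \<in> borel_measurable rademacher"
    unfolding rademacher_def by (auto simp: measurable_def space_uniform_count_measure sets_uniform_count_measure)
  ultimately have "(\<lambda>\<eta>. fst (\<eta> i)) \<in> borel_measurable (net_init_measure :: ('h, 'd) net_init measure)" for i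
    by (rule measurable_compose)
  then show ?thesis by (cases j) (simp_all add: init_signs_def)
qed

lemma borel_measurable_softmax:
  assumes [measurable]: "\<And>x. (\<lambda>\<omega>. f \<omega> x) \<in> borel_measurable N"
  shows "(\<lambda>\<omega>. softmax (f \<omega>) x) \<in> borel_measurable N"
  unfolding softmax_def by measurable

lemma borel_measurable_nn_score:
  assumes [measurable]: "\<And>j. (\<lambda>\<omega>. c \<omega> j) \<in> borel_measurable N" and W: "W \<in> borel_measurable N"
  shows "(\<lambda>\<omega>. nn_score (c \<omega>) (W \<omega>) x) \<in> borel_measurable N"
proof -
  have [measurable]: "(\<lambda>\<omega>. W \<omega> $ i \<bullet> x) \<in> borel_measurable N" for i
    by (rule measurable_compose[OF W])
       (intro borel_measurable_continuous_onI continuous_intros)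
  show ?thesis unfolding nn_score_def relu_def by measurable
qed

lemma continuous_on_softmax:
  assumes "\<And>x. continuous_on A (\<lambda>W. f W x)"
  shows "continuous_on A (\<lambda>W. softmax (f W) x)"
proof -
  have "(\<Sum>z\<in>UNIV. exp (f W z)) \<noteq> 0" for W
    by (rule less_imp_neq[symmetric]) (simp add: sum_pos)
  then show ?thesis unfolding softmax_def by (intro continuous_intros assms) auto
qed

lemma continuous_on_nn_score: "continuous_on A (\<lambda>W. nn_score c W x)"
  unfolding nn_score_def relu_def by (intro continuous_intros)

text \<open>
  The infimum is below \<open>a\<close> exactly if the random set meets the open set \<open>{W. g k W < a}\<close>, an event by the definition
  of a random set.  That open set depends on the sample point through \<open>k = c \<omega>\<close>, which is harmless since \<open>k\<close> takes
  finitely many values.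
\<close>

lemma borel_measurable_INF_random_set:
  fixes g :: "'k \<Rightarrow> 'v::topological_space \<Rightarrow> real"
  assumes D: "random_set N D" "\<And>\<omega>. \<omega> \<in> space N \<Longrightarrow> D \<omega> \<noteq> {}"
    and C: "finite C" "\<And>\<omega>. \<omega> \<in> space N \<Longrightarrow> c \<omega> \<in> C" "\<And>k. {\<omega> \<in> space N. c \<omega> = k} \<in> sets N"
    and g: "\<And>k W. 0 \<le> g k W" "\<And>k a. open {W. g k W < a}"
  shows "(\<lambda>\<omega>. INF W\<in>D \<omega>. g (c \<omega>) W) \<in> borel_measurable N"
proof (rule borel_measurable_iff_less[THEN iffD2], rule allI)
  fix a
  have bdd: "bdd_below (g k ` D \<omega>)" for k \<omega>
    using g(1) by (intro bdd_belowI2[of _ 0]) auto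
  have "{\<omega> \<in> space N. (INF W\<in>D \<omega>. g (c \<omega>) W) < a}
      = (\<Union>k\<in>C. {\<omega> \<in> space N. c \<omega> = k} \<inter> {\<omega> \<in> space N. D \<omega> \<inter> {W. g k W < a} \<noteq> {}})"
    using C(2) by (auto simp: cINF_less_iff[OF D(2) bdd])
  also have "\<dots> \<in> sets N"
    using D(1) g(2) C(1,3) unfolding random_set_def by (intro sets.finite_UN sets.Int) auto
  finally show "{\<omega> \<in> space N. (INF W\<in>D \<omega>. g (c \<omega>) W) < a} \<in> sets N" .
qed

text \<open>
  An infimum over a finite index set is below \<open>a\<close> exactly if one of its members is.
\<close>

lemma open_INF_less:
  fixes f :: "'i::finite \<Rightarrow> 'v::topological_space \<Rightarrow> real"
  assumes "\<And>i. continuous_on UNIV (f i)"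
  shows "open {W. (INF i\<in>UNIV. f i W) < a}"
proof -
  have "{W. (INF i\<in>UNIV. f i W) < a} = (\<Union>i. {W. f i W < a})"
    by (auto simp: cINF_less_iff)
  then show ?thesis using assms by (auto intro!: open_Collect_less continuous_intros)
qed

text \<open>
  The only dependence of the kernels on the sample point, apart from the weights, is through the signs, and
  there are finitely many sign vectors.
\<close>

lemma borel_measurable_INF_signs:
  fixes c :: "'w \<Rightarrow> 'm::finite \<Rightarrow> real" and f :: "('m \<Rightarrow> real) \<Rightarrow> 'i::finite \<Rightarrow> 'v::topological_space \<Rightarrow> real"
  assumes D: "random_set N D" "\<And>\<omega>. \<omega> \<in> space N \<Longrightarrow> D \<omega> \<noteq> {}"
    and c[measurable]: "\<And>j. (\<lambda>\<omega>. c \<omega> j) \<in> borel_measurable N"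
    and signs: "\<And>\<omega> j. \<omega> \<in> space N \<Longrightarrow> c \<omega> j \<in> {-1, 1}"
    and f: "\<And>k i W. 0 \<le> f k i W" "\<And>k i. continuous_on UNIV (f k i)"
  shows "(\<lambda>\<omega>. INF W\<in>D \<omega>. INF i\<in>UNIV. f (c \<omega>) i W) \<in> borel_measurable N"
proof (rule borel_measurable_INF_random_set[OF D, where g = "\<lambda>k W. INF i\<in>UNIV. f k i W"])
  show "finite (PiE UNIV (\<lambda>_::'m. {-1, 1::real}))" by (intro finite_PiE) auto
  show "c \<omega> \<in> PiE UNIV (\<lambda>_. {-1, 1})" if "\<omega> \<in> space N" for \<omega>
    using signs[OF that] by auto
  have "{\<omega> \<in> space N. c \<omega> = k} = {\<omega> \<in> space N. \<forall>j. c \<omega> j = k j}" for k by auto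
  moreover have "{\<omega> \<in> space N. \<forall>j. c \<omega> j = k j} \<in> sets N" for k by measurable
  ultimately show "{\<omega> \<in> space N. c \<omega> = k} \<in> sets N" for k by simp
  show "0 \<le> (INF i\<in>UNIV. f k i W)" for k W by (intro cINF_greatest f) auto
  show "open {W. (INF i\<in>UNIV. f k i W) < a}" for k a by (intro open_INF_less f)
qed

lemma borel_measurable_dobrushin_nn_trans:
  assumes "random_set N D" "\<And>\<omega>. \<omega> \<in> space N \<Longrightarrow> D \<omega> \<noteq> {}"
    and "\<And>j. (\<lambda>\<omega>. c \<omega> j) \<in> borel_measurable N" "\<And>\<omega> j. \<omega> \<in> space N \<Longrightarrow> c \<omega> j \<in> {-1, 1}"
  shows "(\<lambda>\<omega>. dobrushin_trans (nn_trans enc (c \<omega>) ` D \<omega>)) \<in> borel_measurable N"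
  unfolding dobrushin_trans_def image_image
proof (rule borel_measurable_INF_signs[OF assms])
  fix k i W
  show "0 \<le> (case i of (s, s', a) \<Rightarrow> \<Sum>x\<in>UNIV. min (nn_trans enc k W s a x) (nn_trans enc k W s' a x))"
    using nn_softmax(1)[of enc k W] by (auto simp: prob_vector_def intro!: sum_nonneg split: prod.split)
next
  fix k i
  show "continuous_on UNIV (\<lambda>W. case i of (s, s', a) \<Rightarrow> \<Sum>x\<in>UNIV. min (nn_trans enc k W s a x) (nn_trans enc k W s' a x))"
    unfolding nn_trans_def
    by (cases i) (auto intro!: continuous_intros continuous_on_softmax continuous_on_nn_score)
qed

lemma borel_measurable_dobrushin_nn_obs:
  assumes "random_set N D" "\<And>\<omega>. \<omega> \<in> space N \<Longrightarrow> D \<omega> \<noteq> {}"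
    and "\<And>j. (\<lambda>\<omega>. c \<omega> j) \<in> borel_measurable N" "\<And>\<omega> j. \<omega> \<in> space N \<Longrightarrow> c \<omega> j \<in> {-1, 1}"
  shows "(\<lambda>\<omega>. dobrushin_obs (nn_obs enc (c \<omega>) ` D \<omega>)) \<in> borel_measurable N"
  unfolding dobrushin_obs_def image_image
proof (rule borel_measurable_INF_signs[OF assms])
  fix k i W
  show "0 \<le> (case i of (s, s') \<Rightarrow> \<Sum>y\<in>UNIV. min (nn_obs enc k W s y) (nn_obs enc k W s' y))"
    using nn_softmax(2)[of enc k W] by (auto simp: prob_vector_def intro!: sum_nonneg split: prod.split)
next
  fix k i
  show "continuous_on UNIV (\<lambda>W. case i of (s, s') \<Rightarrow> \<Sum>y\<in>UNIV. min (nn_obs enc k W s y) (nn_obs enc k W s' y))"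
    unfolding nn_obs_def
    by (cases i) (auto intro!: continuous_intros continuous_on_softmax continuous_on_nn_score)
qed

text \<open>
  By Fubini the probability of \<open>J\<close> is at least \<open>(1 - \<delta>) (1 - \<gamma>)\<close>.
\<close>

lemma prob_pair_ge_if_sections_ge:
  assumes N: "prob_space N" and M: "prob_space M" and J: "J \<in> sets (N \<Otimes>\<^sub>M M)" and E: "E \<in> sets N"
    and sections: "\<And>\<omega>. \<omega> \<in> E \<Longrightarrow> 1 - \<delta> \<le> measure M (Pair \<omega> -` J)"
    and "1 - \<gamma> \<le> measure N E" "0 \<le> \<delta>" "\<delta> \<le> 1" "0 \<le> \<gamma>"
  shows "1 - (\<delta> + \<gamma>) \<le> measure (N \<Otimes>\<^sub>M M) J"
proof -
  interpret N: prob_space N by fact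
  interpret M: prob_space M by fact
  interpret NM: prob_space "N \<Otimes>\<^sub>M M" by (intro prob_space_pair N M)
  have "ennreal ((1 - \<delta>) * measure N E) = (\<integral>\<^sup>+\<omega>. ennreal (1 - \<delta>) * indicator E \<omega> \<partial>N)"
    using assms by (simp add: nn_integral_cmult_indicator N.emeasure_eq_measure ennreal_mult')
  also have "\<dots> \<le> (\<integral>\<^sup>+\<omega>. emeasure M (Pair \<omega> -` J) \<partial>N)"
    using sections by (intro nn_integral_mono) (auto simp: M.emeasure_eq_measure indicator_def ennreal_leI)
  also have "\<dots> = emeasure (N \<Otimes>\<^sub>M M) J" using M.emeasure_pair_measure_alt[OF J] by simp
  finally have "(1 - \<delta>) * measure N E \<le> measure (N \<Otimes>\<^sub>M M) J"
    by (simp add: NM.emeasure_eq_measure)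
  moreover have "(1 - \<delta>) * (1 - \<gamma>) \<le> (1 - \<delta>) * measure N E"
    using assms by (intro mult_left_mono) auto
  moreover have "0 \<le> \<delta> * \<gamma>" using assms by simp
  ultimately show ?thesis by (simp add: algebra_simps)
qed

section \<open>The average belief error\<close>

theorem corollary4p6:
  fixes \<nu>0 :: "'s::finite \<Rightarrow> real" and act :: "nat \<Rightarrow> 'a::finite" and T :: nat and \<delta>b :: real
    and M :: "'m measure" and S :: "nat \<Rightarrow> 'm \<Rightarrow> 's" and Y :: "nat \<Rightarrow> 'm \<Rightarrow> 'o::finite"
    (* log-linear model *)
    and \<phi>p :: "'s \<Rightarrow> 'a \<Rightarrow> 's \<Rightarrow> real ^ 'd" and \<phi>o :: "'s \<Rightarrow> 'o \<Rightarrow> real ^ 'e"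
    and B \<nu>min \<nu>max r\<Theta> \<delta>\<theta> \<delta>w \<kappa>P \<kappa>O \<alpha> cb :: real
    and \<Theta> \<Theta>star :: "(real ^ 'd) \<times> (real ^ 'e)"
    and X :: "nat \<Rightarrow> 'm \<Rightarrow> real"
    (* neural-softmax model *)
    and xp :: "'s \<Rightarrow> 'a \<Rightarrow> 's \<Rightarrow> real ^ 'dp" and xo :: "'s \<Rightarrow> 'o \<Rightarrow> real ^ 'do"
    and Dp :: "('h::finite, 'dp::finite) net_init \<times> ('h, 'do::finite) net_init \<Rightarrow> (real ^ 'dp ^ ('h + 'h)) set"
    and Do :: "('h, 'dp) net_init \<times> ('h, 'do) net_init \<Rightarrow> (real ^ 'do ^ ('h + 'h)) set"
    and Wp Wp_star :: "('h, 'dp) net_init \<times> ('h, 'do) net_init \<Rightarrow> real ^ 'dp ^ ('h + 'h)"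
    and Wo Wo_star :: "('h, 'dp) net_init \<times> ('h, 'do) net_init \<Rightarrow> real ^ 'do ^ ('h + 'h)"
    and P_true :: "'s \<Rightarrow> 'a \<Rightarrow> 's \<Rightarrow> real" and \<Phi>_true :: "'s \<Rightarrow> 'o \<Rightarrow> real"
    and r0 BN \<delta>N :: real and \<epsilon>p \<epsilon>o :: "nat \<Rightarrow> real \<Rightarrow> real"
    and EN :: "(('h, 'dp) net_init \<times> ('h, 'do) net_init) set"
    and \<kappa>PN \<kappa>ON \<alpha>N cbN :: "('h, 'dp) net_init \<times> ('h, 'do) net_init \<Rightarrow> real"
    and XN :: "('h, 'dp) net_init \<times> ('h, 'do) net_init \<Rightarrow> nat \<Rightarrow> 'm \<Rightarrow> real"
  assumes \<nu>0: "prob_vector \<nu>0"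
    and T: "T \<ge> 1"
    and \<delta>b: "0 < \<delta>b" "\<delta>b < 1"
    (* notation, log-linear model *)
    and \<kappa>P_def: "\<kappa>P = dobrushin_trans ((\<lambda>\<Xi>. loglin_trans \<phi>p (fst \<Xi>)) ` cball \<Theta>star r\<Theta>)"
    and \<kappa>O_def: "\<kappa>O = dobrushin_obs ((\<lambda>\<Xi>. loglin_obs \<phi>o (snd \<Xi>)) ` cball \<Theta>star r\<Theta>)"
    and \<alpha>_def: "\<alpha> = (1 - \<kappa>P) * (4 - 3 * \<kappa>O)"
    and cb_def: "cb = B * (\<delta>w + (3 - 2 * \<kappa>O) / 2 * \<delta>\<theta>)"
    and X_def: "X = (\<lambda>t x. tv_dist
          (belief \<nu>0 (loglin_trans \<phi>p (fst \<Theta>)) (loglin_obs \<phi>o (snd \<Theta>)) act (\<lambda>k. Y k x) t)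
          (belief \<nu>0 (loglin_trans \<phi>p (fst \<Theta>star)) (loglin_obs \<phi>o (snd \<Theta>star)) act (\<lambda>k. Y k x) t))"
    (* notation, neural-softmax model *)
    and \<kappa>PN_def: "\<kappa>PN = (\<lambda>\<omega>. dobrushin_trans (nn_trans xp (init_signs (fst \<omega>)) ` Dp \<omega>))"
    and \<kappa>ON_def: "\<kappa>ON = (\<lambda>\<omega>. dobrushin_obs (nn_obs xo (init_signs (snd \<omega>)) ` Do \<omega>))"
    and \<alpha>N_def: "\<alpha>N = (\<lambda>\<omega>. (1 - \<kappa>PN \<omega>) * (4 - 3 * \<kappa>ON \<omega>))"
    and cbN_def: "cbN = (\<lambda>\<omega>. BN * norm (Wo \<omega> - Wo_star \<omega>) + 2 * \<epsilon>o CARD('h + 'h) \<delta>N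
          + (3 - 2 * \<kappa>ON \<omega>) * (BN / 2 * norm (Wp \<omega> - Wp_star \<omega>) + \<epsilon>p CARD('h + 'h) \<delta>N))"
    and EN_def: "EN = lin_event r0 xp xo Dp Do (\<epsilon>p CARD('h + 'h) \<delta>N) (\<epsilon>o CARD('h + 'h) \<delta>N)"
    and XN_def: "XN = (\<lambda>\<omega> t x. tv_dist
          (belief \<nu>0 (nn_trans xp (init_signs (fst \<omega>)) (Wp \<omega>)) (nn_obs xo (init_signs (snd \<omega>)) (Wo \<omega>))
             act (\<lambda>k. Y k x) t)
          (belief \<nu>0 (nn_trans xp (init_signs (fst \<omega>)) (Wp_star \<omega>)) (nn_obs xo (init_signs (snd \<omega>)) (Wo_star \<omega>))
             act (\<lambda>k. Y k x) t))"
  shows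
    (* first conjunct: log-linear model; second conjunct: neural-softmax model *)
    "((\<forall>s a s'. norm (\<phi>p s a s') \<le> B) \<and> (\<forall>s y. norm (\<phi>o s y) \<le> B) \<and>
      \<nu>max < 1 \<and> (\<forall>s. \<nu>0 s \<le> \<nu>max \<and> \<nu>min \<le> \<nu>0 s) \<and> 0 < \<nu>min \<and>
      r\<Theta> > 0 \<and>
      0 < \<kappa>P \<and> \<kappa>P \<le> 1 \<and> 0 < \<kappa>O \<and> \<kappa>O \<le> 1 \<and> \<alpha> < 1 \<and>
      norm (\<Theta> - \<Theta>star) \<le> r\<Theta> \<and>
      norm (fst \<Theta> - fst \<Theta>star) \<le> \<delta>\<theta> \<and> norm (snd \<Theta> - snd \<Theta>star) \<le> \<delta>w \<and>
      generated_under \<nu>0 (loglin_trans \<phi>p (fst \<Theta>star)) (loglin_obs \<phi>o (snd \<Theta>star)) act M S Y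
      \<longrightarrow>
      (\<forall>t<T. X t \<in> borel_measurable (history_sigma M act Y t t)) \<and>
      measure M {x \<in> space M. (1 / real T) * (\<Sum>t<T. X t x) \<le> avg_belief_bound cb \<alpha> \<delta>b T} \<ge> 1 - \<delta>b)
    \<and>
     (0 < \<delta>N \<and> \<delta>N < 1 \<and> 0 \<le> r0 \<and> r0 \<le> 1 \<and>
      0 \<le> \<epsilon>p CARD('h + 'h) \<delta>N \<and> 0 \<le> \<epsilon>o CARD('h + 'h) \<delta>N \<and>
      (\<forall>\<omega>\<in>space init_measure.
         (\<forall>s a s'. norm (nn_feature r0 (init_signs (fst \<omega>)) (xp s a s') (init_weights (fst \<omega>))) \<le> BN) \<and>
         (\<forall>s y. norm (nn_feature r0 (init_signs (snd \<omega>)) (xo s y) (init_weights (snd \<omega>))) \<le> BN) \<and>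
         bounded (Dp \<omega>) \<and> convex (Dp \<omega>) \<and> init_weights (fst \<omega>) \<in> interior (Dp \<omega>) \<and>
         bounded (Do \<omega>) \<and> convex (Do \<omega>) \<and> init_weights (snd \<omega>) \<in> interior (Do \<omega>) \<and>
         Wp \<omega> \<in> Dp \<omega> \<and> Wo \<omega> \<in> Do \<omega> \<and> Wp_star \<omega> \<in> Dp \<omega> \<and> Wo_star \<omega> \<in> Do \<omega> \<and>
         nn_trans xp (init_signs (fst \<omega>)) (Wp_star \<omega>) = P_true \<and>
         nn_obs xo (init_signs (snd \<omega>)) (Wo_star \<omega>) = \<Phi>_true) \<and>
      measure init_measure EN \<ge> 1 - \<delta>N \<and>
      generated_under \<nu>0 P_true \<Phi>_true act M S Y
      \<longrightarrow>
      (\<forall>\<omega>\<in>space init_measure. \<forall>t<T. XN \<omega> t \<in> borel_measurable (history_sigma M act Y t t)) \<and>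
      (\<forall>\<omega>\<in>EN. \<alpha>N \<omega> < 1 \<longrightarrow>
         measure M {x \<in> space M. (1 / real T) * (\<Sum>t<T. XN \<omega> t x) \<le> avg_belief_bound (cbN \<omega>) (\<alpha>N \<omega>) \<delta>b T}
           \<ge> 1 - \<delta>b) \<and>
      (random_set init_measure Dp \<and> random_set init_measure Do \<and>
       Wp \<in> borel_measurable init_measure \<and> Wo \<in> borel_measurable init_measure \<and>
       Wp_star \<in> borel_measurable init_measure \<and> Wo_star \<in> borel_measurable init_measure \<and>
       (\<forall>\<omega>\<in>EN. \<alpha>N \<omega> < 1)
       \<longrightarrow>
       measure (init_measure \<Otimes>\<^sub>M M)
         {(\<omega>, x) \<in> space (init_measure \<Otimes>\<^sub>M M).
            (1 / real T) * (\<Sum>t<T. XN \<omega> t x) \<le> avg_belief_bound (cbN \<omega>) (\<alpha>N \<omega>) \<delta>b T}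
         \<ge> 1 - (\<delta>b + \<delta>N)))"
proof ((rule conjI; rule impI), goal_cases loglin neural)
  case loglin
  note hyps = this
  interpret two_filters \<nu>0 act "loglin_trans \<phi>p (fst \<Theta>)" "loglin_trans \<phi>p (fst \<Theta>star)"
    "loglin_obs \<phi>o (snd \<Theta>)" "loglin_obs \<phi>o (snd \<Theta>star)" \<kappa>P \<kappa>O "B * \<delta>\<theta> / 2" "B * \<delta>w / 2"
    unfolding \<kappa>P_def \<kappa>O_def using hyps by (intro two_filters_loglin \<nu>0) auto
  have "X = (\<lambda>t x. err (\<lambda>k. Y k x) t)" by (simp add: X_def err_def)
  moreover have "rate = \<alpha>" "drift = cb"
    by (simp_all add: rate_def \<alpha>_def drift_def cb_def field_simps)
  ultimately show ?case
    using average_error_concentration[of M S Y \<delta>b T] hyps \<delta>b T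
    by (auto simp: err_def intro: borel_measurable_belief_error_history)
next
  case neural
  note hyps = this
  from hyps have gen: "generated_under \<nu>0 P_true \<Phi>_true act M S Y" by blast
  have \<delta>N: "0 < \<delta>N" "\<delta>N < 1" and EN: "1 - \<delta>N \<le> measure init_measure EN" using hyps by blast+
  let ?N = "init_measure :: (('h, 'dp) net_init \<times> ('h, 'do) net_init) measure"
  let ?cp = "\<lambda>\<omega> :: ('h, 'dp) net_init \<times> ('h, 'do) net_init. init_signs (fst \<omega>)"
  let ?co = "\<lambda>\<omega> :: ('h, 'dp) net_init \<times> ('h, 'do) net_init. init_signs (snd \<omega>)"
  let ?good = "\<lambda>\<omega>. {x \<in> space M. (1 / real T) * (\<Sum>t<T. XN \<omega> t x) \<le> avg_belief_bound (cbN \<omega>) (\<alpha>N \<omega>) \<delta>b T}"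
  have cond: "1 - \<delta>b \<le> measure M (?good \<omega>)" if \<omega>: "\<omega> \<in> EN" and "\<alpha>N \<omega> < 1" for \<omega>
  proof -
    have space: "\<omega> \<in> space ?N" using \<omega> by (simp add: EN_def lin_event_def)
    have features: "norm (nn_feature r0 (?cp \<omega>) (xp s a s') (init_weights (fst \<omega>))) \<le> BN"
      "norm (nn_feature r0 (?co \<omega>) (xo s y) (init_weights (snd \<omega>))) \<le> BN" for s a s' y
      using hyps space by blast+
    have lin: "W \<in> Dp \<omega> \<Longrightarrow> \<bar>nn_score (?cp \<omega>) W (xp s a s')
          - nn_lin_score r0 (?cp \<omega>) (init_weights (fst \<omega>)) W (xp s a s')\<bar> \<le> \<epsilon>p CARD('h + 'h) \<delta>N"
      "V \<in> Do \<omega> \<Longrightarrow> \<bar>nn_score (?co \<omega>) V (xo s y)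
          - nn_lin_score r0 (?co \<omega>) (init_weights (snd \<omega>)) V (xo s y)\<bar> \<le> \<epsilon>o CARD('h + 'h) \<delta>N" for W V s a s' y
      using \<omega> unfolding EN_def lin_event_def by blast+
    have weights: "Wp \<omega> \<in> Dp \<omega>" "Wp_star \<omega> \<in> Dp \<omega>" "Wo \<omega> \<in> Do \<omega>" "Wo_star \<omega> \<in> Do \<omega>"
      using hyps space by blast+
    interpret two_filters \<nu>0 act "nn_trans xp (?cp \<omega>) (Wp \<omega>)" "nn_trans xp (?cp \<omega>) (Wp_star \<omega>)"
      "nn_obs xo (?co \<omega>) (Wo \<omega>)" "nn_obs xo (?co \<omega>) (Wo_star \<omega>)" "\<kappa>PN \<omega>" "\<kappa>ON \<omega>"
      "BN / 2 * norm (Wp \<omega> - Wp_star \<omega>) + \<epsilon>p CARD('h + 'h) \<delta>N"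
      "BN / 2 * norm (Wo \<omega> - Wo_star \<omega>) + \<epsilon>o CARD('h + 'h) \<delta>N"
      unfolding \<kappa>PN_def \<kappa>ON_def
      by (rule two_filters_nn[OF \<nu>0, where r = r0 and ?Wp0.0 = "init_weights (fst \<omega>)" and ?Wo0.0 = "init_weights (snd \<omega>)"])
         (fact features lin weights)+
    have "rate = \<alpha>N \<omega>" "drift = cbN \<omega>"
      unfolding rate_def \<alpha>N_def drift_def cbN_def by (simp_all add: field_simps)
    moreover have "XN \<omega> t x = err (\<lambda>k. Y k x) t" for t x by (simp add: XN_def err_def)
    moreover have "generated_under \<nu>0 (nn_trans xp (?cp \<omega>) (Wp_star \<omega>)) (nn_obs xo (?co \<omega>) (Wo_star \<omega>)) act M S Y"
    proof -
      have "nn_trans xp (?cp \<omega>) (Wp_star \<omega>) = P_true" "nn_obs xo (?co \<omega>) (Wo_star \<omega>) = \<Phi>_true"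
        using hyps space by blast+
      then show ?thesis using gen by simp
    qed
    ultimately show ?thesis
      using average_error_concentration[of M S Y \<delta>b T] \<open>\<alpha>N \<omega> < 1\<close> \<delta>b T by simp
  qed
  show ?case
  proof (intro conjI ballI allI impI, goal_cases history conditional joint)
    case (history \<omega> t)
    show ?case unfolding XN_def by (rule borel_measurable_belief_error_history)
  next
    case (conditional \<omega>)
    then show ?case by (rule cond)
  next
    case joint
    note regular = this
    have M: "prob_space M" using gen by (simp add: generated_under_def)
    have nonempty: "Dp \<omega> \<noteq> {}" "Do \<omega> \<noteq> {}" if "\<omega> \<in> space ?N" for \<omega>
      using hyps that by blast+
    have cp: "(\<lambda>\<omega>. ?cp \<omega> j) \<in> borel_measurable ?N" "(\<lambda>\<omega>. ?co \<omega> j) \<in> borel_measurable ?N" for j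
      unfolding init_measure_def
      by (rule measurable_compose[OF measurable_fst borel_measurable_init_signs]
            measurable_compose[OF measurable_snd borel_measurable_init_signs])+
    have signs: "?cp \<omega> j \<in> {-1, 1}" "?co \<omega> j \<in> {-1, 1}" if "\<omega> \<in> space ?N" for \<omega> j
      using that init_signs_in[of "fst \<omega>" j] init_signs_in[of "snd \<omega>" j]
      by (auto simp: init_measure_def space_pair_measure)
    have [measurable]: "\<kappa>PN \<in> borel_measurable ?N" "\<kappa>ON \<in> borel_measurable ?N"
      unfolding \<kappa>PN_def \<kappa>ON_def using regular
      by (intro borel_measurable_dobrushin_nn_trans borel_measurable_dobrushin_nn_obs nonempty cp signs; blast)+
    have weights[measurable]: "Wp \<in> borel_measurable ?N" "Wo \<in> borel_measurable ?N"
      "Wp_star \<in> borel_measurable ?N" "Wo_star \<in> borel_measurable ?N"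
      using regular by auto
    have Y: "(\<lambda>z. Y k (snd z)) \<in> measurable (?N \<Otimes>\<^sub>M M) (count_space UNIV)" if "1 \<le> k" for k
      using gen that by (intro measurable_compose[OF measurable_snd]) (simp add: generated_under_def)
    have trans: "(\<lambda>z. nn_trans xp (?cp (fst z)) (W (fst z)) s a s') \<in> borel_measurable (?N \<Otimes>\<^sub>M M)"
      if "W \<in> borel_measurable ?N" for W s a s'
      unfolding nn_trans_def
      by (intro borel_measurable_softmax borel_measurable_nn_score
            measurable_compose[OF measurable_fst cp(1)] measurable_compose[OF measurable_fst that])
    have obs: "(\<lambda>z. nn_obs xo (?co (fst z)) (W (fst z)) s y) \<in> borel_measurable (?N \<Otimes>\<^sub>M M)"
      if "W \<in> borel_measurable ?N" for W s y
      unfolding nn_obs_def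
      by (intro borel_measurable_softmax borel_measurable_nn_score
            measurable_compose[OF measurable_fst cp(2)] measurable_compose[OF measurable_fst that])
    have "(\<lambda>z. XN (fst z) t (snd z)) \<in> borel_measurable (?N \<Otimes>\<^sub>M M)" for t
      unfolding XN_def
      by (intro borel_measurable_tv_dist borel_measurable_belief trans obs weights Y)
    then have average: "(\<lambda>z. (1 / real T) * (\<Sum>t<T. XN (fst z) t (snd z))) \<in> borel_measurable (?N \<Otimes>\<^sub>M M)"
      by (intro borel_measurable_times borel_measurable_const borel_measurable_sum)
    have bound: "(\<lambda>\<omega>. avg_belief_bound (cbN \<omega>) (\<alpha>N \<omega>) \<delta>b T) \<in> borel_measurable ?N"
      unfolding avg_belief_bound_def cbN_def \<alpha>N_def by measurable
    let ?J = "{z \<in> space (?N \<Otimes>\<^sub>M M). (1 / real T) * (\<Sum>t<T. XN (fst z) t (snd z))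
        \<le> avg_belief_bound (cbN (fst z)) (\<alpha>N (fst z)) \<delta>b T}"
    have J: "?J \<in> sets (?N \<Otimes>\<^sub>M M)"
      by (rule borel_measurable_le[OF average measurable_compose[OF measurable_fst bound]])
    \<comment> \<open>a non-measurable set would have measure 0, but the event has positive measure\<close>
    have "EN \<in> sets ?N"
    proof (rule ccontr)
      assume "EN \<notin> sets ?N"
      then have "measure ?N EN = 0" by (rule measure_notin_sets)
      then show False using EN \<delta>N by simp
    qed
    moreover have "1 - \<delta>b \<le> measure M (Pair \<omega> -` ?J)" if "\<omega> \<in> EN" for \<omega>
    proof -
      have "\<omega> \<in> space ?N" using that by (simp add: EN_def lin_event_def)
      then have "Pair \<omega> -` ?J = ?good \<omega>" by (auto simp: space_pair_measure)
      then show ?thesis using cond[OF that] regular that by simp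
    qed
    ultimately have "1 - (\<delta>b + \<delta>N) \<le> measure (?N \<Otimes>\<^sub>M M) ?J"
      using EN \<delta>N \<delta>b by (intro prob_pair_ge_if_sections_ge[OF prob_space_init_measure M J]) auto
    then show ?case by (simp add: case_prod_unfold)
  qed
qed

end
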